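(* There are absolute constants $C, c>0$ such that for every positive integer $n$ and every convex body $K \subset B_\infty^n=[-1,1]^n$, $$E \le C\sqrt{n}\int_{cE/n}^{1} \sqrt{\mathrm{VC}(K,ct)}\,\log(2/t)\,dt,$$ where $E = \mathbb{E}\,\big\|\sum_{i=1}^n g_i e_i\big\|_{K^\circ}$.
   Context: $g_1,\dots,g_n$ are independent standard Gaussian random variables and $(e_i)_{i=1}^n$ is the canonical basis of $\mathbb{R}^n$. $K^\circ$ is the polar of $K$, and $\|y\|_{K^\circ} = \sup_{x\in K}\langle x,y\rangle$ (which is the Minkowski functional of $K^\circ$ when $0$ is interior to $K$). For a convex body $K \subset \mathbb{R}^n$ and $t>0$, $\mathrm{VC}(K,t)$ is the maximal cardinality of a subset $\sigma \subset \{1,\dots,n\}$ such that the coordinate projection $P_\sigma K$ of $K$ onto $\mathbb{R}^\sigma$ contains a cube of the form $x + [0,t]^\sigma$ for some $x \in \mathbb{R}^\sigma$; if no such nonempty $\sigma$ exists, $\mathrm{VC}(K,t)=0$. *)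

theory Defs
  imports "HOL-Probability.Probability"
begin

text \<open>
  The dimension ranges over all positive integers inside the statement, below the choice of the
  absolute constants, so it cannot be a type. The space \<open>\<real>\<^sup>n\<close> is the library's
  \<^const>\<open>Euclidean_space\<close> \<open>n\<close>: functions \<open>nat \<Rightarrow> real\<close> vanishing at every \<open>i \<ge> n\<close>, with the product
  topology. Coordinates are thus indexed by \<open>{..<n}\<close> instead of \<open>{1..n}\<close>.
\<close>

text \<open>
  Since \<open>nat \<Rightarrow> real\<close> is no instance of \<open>real_vector\<close>, convexity is written out coordinatewise.
  Compactness in \<open>Euclidean_space n\<close> includes \<open>K \<subseteq> topspace (Euclidean_space n)\<close>.
\<close>

definition convex_body :: "nat \<Rightarrow> (nat \<Rightarrow> real) set \<Rightarrow> bool" where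
  "convex_body n K \<longleftrightarrow>
     (\<forall>x\<in>K. \<forall>y\<in>K. \<forall>u\<ge>0. \<forall>v\<ge>0. u + v = 1 \<longrightarrow> (\<lambda>i. u * x i + v * y i) \<in> K) \<and>
     compactin (Euclidean_space n) K \<and>
     (Euclidean_space n) interior_of K \<noteq> {}"

definition sup_cube :: "nat \<Rightarrow> (nat \<Rightarrow> real) set" where
  "sup_cube n = {x \<in> topspace (Euclidean_space n). \<forall>i<n. x i \<in> {-1..1}}"

definition canonical_vec :: "nat \<Rightarrow> nat \<Rightarrow> real" where
  "canonical_vec i = (\<lambda>j. if j = i then 1 else 0)"

definition polar_norm :: "nat \<Rightarrow> (nat \<Rightarrow> real) set \<Rightarrow> (nat \<Rightarrow> real) \<Rightarrow> real" where
  "polar_norm n K y = (SUP x\<in>K. \<Sum>i<n. x i * y i)"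

text \<open>
  Independent standard Gaussian variables are realised as the coordinates \<open>g i\<close>, \<open>i < n\<close>, on the
  product probability space of \<open>n\<close> copies of the standard normal distribution; the expectation
  depends only on their joint law.
\<close>

definition gaussian_product :: "nat \<Rightarrow> (nat \<Rightarrow> real) measure" where
  "gaussian_product n = (\<Pi>\<^sub>M i\<in>{..<n}. density lborel std_normal_density)"

definition expected_polar_norm :: "nat \<Rightarrow> (nat \<Rightarrow> real) set \<Rightarrow> real" where
  "expected_polar_norm n K =
     (\<integral>g. polar_norm n K (\<lambda>j. \<Sum>i<n. g i * canonical_vec i j) \<partial>gaussian_product n)"

text \<open>
  \<open>\<real>\<^sup>\<sigma>\<close> is the set \<open>\<sigma> \<rightarrow>\<^sub>E UNIV\<close> of functions that are \<open>undefined\<close> off \<open>\<sigma>\<close>, so the projection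
  \<open>P\<^sub>\<sigma>\<close> is \<^const>\<open>restrict\<close>. The element \<open>0\<close> is the value when no nonempty \<open>\<sigma>\<close> qualifies.
\<close>

definition coord_proj :: "nat set \<Rightarrow> (nat \<Rightarrow> real) set \<Rightarrow> (nat \<Rightarrow> real) set" where
  "coord_proj \<sigma> K = (\<lambda>y. restrict y \<sigma>) ` K"

definition VC :: "nat \<Rightarrow> (nat \<Rightarrow> real) set \<Rightarrow> real \<Rightarrow> nat" where
  "VC n K t =
     Max (insert 0 {card \<sigma> |\<sigma>. \<sigma> \<subseteq> {..<n} \<and> \<sigma> \<noteq> {} \<and>
       (\<exists>x \<in> \<sigma> \<rightarrow>\<^sub>E UNIV. (\<Pi>\<^sub>E i\<in>\<sigma>. {x i .. x i + t}) \<subseteq> coord_proj \<sigma> K)})"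

end

theory Submission
  imports Defs
begin

text \<open>
  The expectation \<open>E\<close> is the mean of the supremum over \<open>K\<close> of the Gaussian process
  \<open>x \<mapsto> \<Sum>i<n. x i * g i\<close>, and the theorem is Dudley's entropy integral for this process, with the
  metric entropy of \<open>K\<close> estimated by its combinatorial dimension.

  The entropy estimate (\<open>entropy_le_VC\<close>) is the main point. Let \<open>A\<close> be a finite subset of \<open>K\<close> whose points
  have mutual Euclidean distance at least \<open>t * sqrt n\<close>. Then \<open>ln (card A)\<close> is at most a constant times
  \<open>VC n K (t/20) * ln (2/t)\<close>, without any dependence on \<open>n\<close>. This is the theorem of Mendelson and
  Vershynin, and the proof is theirs. Three ideas enter.

  \<^item> A separated set has, on average over pairs of its points, a large spread in some coordinate.
    In such a coordinate some grid level splits the set into a lower and an upper part, one grid step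
    apart, with \<open>sqrt (card B) \<le> sqrt (card L) + sqrt (card U)\<close> (\<open>separating_level\<close>): otherwise the
    tails of the coordinate would decay so fast that its variance would be small. Splitting
    recursively, one finds that at least \<open>sqrt (card A)\<close> families of coordinates and levels are shattered
    by \<open>A\<close> (\<open>sqrt_card_le_card_shattered\<close>), because a family shattered by both halves yields one more,
    extended by the splitting coordinate.

  \<^item> By convexity, a family shattered by a subset of \<open>K\<close> gives a cube in the projection of \<open>K\<close> onto
    the coordinates of the family (\<open>shattered_imp_cube\<close>). Hence every shattered family has at most
    \<open>VC n K (t/20)\<close> coordinates, and if there are few coordinates to choose from, there are few
    shattered families.

  \<^item> A random choice of about \<open>ln (card A) / t\<^sup>2\<close> coordinates keeps the points of \<open>A\<close> separated
    (\<open>few_coordinates_separate\<close>), so that the count does not see \<open>n\<close>. The number of coordinates involves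
    \<open>ln (card A)\<close> again, but the count of families can be weighted so that this occurrence is
    absorbed by the left-hand side (\<open>card_separated_le\<close>).

  The probabilistic half is chaining along the scales \<open>(1/2)^j\<close> (\<open>chaining\<close>). It stops at a
  scale proportional to \<open>E/n\<close>: below that scale the process contributes at most the scale times \<open>n\<close>, a
  small fraction of \<open>E\<close> that is moved to the left. This is where the lower limit of the
  integral comes from. As the integrand is decreasing, the sum over scales is dominated by
  the integral.
\<close>

section \<open>Convexity turns sign patterns into cubes\<close>

definition coord_convex :: "('i \<Rightarrow> real) set \<Rightarrow> bool" where
  "coord_convex C \<longleftrightarrow>
     (\<forall>x\<in>C. \<forall>y\<in>C. \<forall>u\<ge>0. \<forall>v\<ge>0. u + v = 1 \<longrightarrow> (\<lambda>i. u * x i + v * y i) \<in> C)"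

lemma coord_convexD:
  "coord_convex C \<Longrightarrow> x \<in> C \<Longrightarrow> y \<in> C \<Longrightarrow> 0 \<le> u \<Longrightarrow> 0 \<le> v \<Longrightarrow> u + v = 1 \<Longrightarrow>
    (\<lambda>i. u * x i + v * y i) \<in> C"
  unfolding coord_convex_def by blast

lemma coord_convex_halfspaces:
  assumes "coord_convex C"
  shows "coord_convex {x \<in> C. x i \<le> b}" and "coord_convex {x \<in> C. b \<le> x i}"
proof -
  have *: "b = u * b + v * b" if "u + v = 1" for u v :: real
    using that by (metis distrib_right mult_1)
  show "coord_convex {x \<in> C. x i \<le> b}"
    unfolding coord_convex_def
    by (auto intro!: coord_convexD[OF assms]) (metis * add_mono mult_left_mono)
  show "coord_convex {x \<in> C. b \<le> x i}"
    unfolding coord_convex_def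
    by (auto intro!: coord_convexD[OF assms]) (metis * add_mono mult_left_mono)
qed

text \<open>
  If a convex set meets all the octants around \<open>z\<close>, it contains a point that agrees with \<open>z\<close>. The
  induction fixes one coordinate \<open>j\<close> at a time. Each of the halves \<open>x j \<le> z j\<close> and \<open>z j \<le> x j\<close> still meets
  all octants in the remaining coordinates, and the segment between the two points obtained from the
  halves crosses the hyperplane \<open>x j = z j\<close>.
\<close>
lemma octants_imp_point:
  assumes "finite \<sigma>" and "coord_convex C"
    and "\<And>\<epsilon>. \<exists>x\<in>C. \<forall>i\<in>\<sigma>. if i \<in> \<epsilon> then z i \<le> x i else x i \<le> z i"
  shows "\<exists>x\<in>C. \<forall>i\<in>\<sigma>. x i = z i"
  using assms
proof (induction \<sigma> arbitrary: C rule: finite_induct)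
  case empty
  then show ?case by auto
next
  case (insert j \<sigma>)
  have "\<exists>x\<in>{x \<in> C. x j \<le> z j}. \<forall>i\<in>\<sigma>. x i = z i"
  proof (rule insert.IH)
    show "coord_convex {x \<in> C. x j \<le> z j}"
      using insert.prems(1) by (rule coord_convex_halfspaces)
    fix \<epsilon>
    obtain x where "x \<in> C" "\<forall>i\<in>insert j \<sigma>. if i \<in> \<epsilon> - {j} then z i \<le> x i else x i \<le> z i"
      using insert.prems(2) by blast
    then show "\<exists>x\<in>{x \<in> C. x j \<le> z j}. \<forall>i\<in>\<sigma>. if i \<in> \<epsilon> then z i \<le> x i else x i \<le> z i"
      using insert.hyps(2) by (intro bexI[of _ x]) (auto split: if_splits)
  qed
  then obtain x where x: "x \<in> C" "x j \<le> z j" "\<forall>i\<in>\<sigma>. x i = z i" by auto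
  have "\<exists>x\<in>{x \<in> C. z j \<le> x j}. \<forall>i\<in>\<sigma>. x i = z i"
  proof (rule insert.IH)
    show "coord_convex {x \<in> C. z j \<le> x j}"
      using insert.prems(1) by (rule coord_convex_halfspaces)
    fix \<epsilon>
    obtain x where "x \<in> C" "\<forall>i\<in>insert j \<sigma>. if i \<in> insert j \<epsilon> then z i \<le> x i else x i \<le> z i"
      using insert.prems(2) by blast
    then show "\<exists>x\<in>{x \<in> C. z j \<le> x j}. \<forall>i\<in>\<sigma>. if i \<in> \<epsilon> then z i \<le> x i else x i \<le> z i"
      using insert.hyps(2) by (intro bexI[of _ x]) (auto split: if_splits)
  qed
  then obtain y where y: "y \<in> C" "z j \<le> y j" "\<forall>i\<in>\<sigma>. y i = z i" by auto
  show ?case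
  proof (cases "x j = y j")
    case True
    then show ?thesis using x y by (intro bexI[of _ x]) auto
  next
    case False
    then have d: "y j - x j > 0" using x y by auto
    define u where "u = (y j - z j) / (y j - x j)"
    define v where "v = (z j - x j) / (y j - x j)"
    have uv: "u + v = 1" "u \<ge> 0" "v \<ge> 0"
      using d x y by (auto simp: u_def v_def add_divide_distrib[symmetric])
    have "u * x j + v * y j = z j"
      using d unfolding u_def v_def by (simp add: divide_simps) algebra
    moreover have "u * w + v * w = w" for w using uv by (metis distrib_right mult_1)
    ultimately show ?thesis
      using coord_convexD[OF insert.prems(1) x(1) y(1) uv(2,3,1)] x y
      by (intro bexI[of _ "\<lambda>i. u * x i + v * y i"]) auto
  qed
qed

section \<open>A coordinate with large spread has a separating level\<close>
lemma sum_weighted_tails: "(\<Sum>j<J. real (2 * j + 1) * (1/2) ^ Suc j) = 3 - (2 * real J + 3) / 2 ^ J"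
  by (induction J) (auto simp: field_simps)

text \<open>
  A layer-cake formula on a grid: \<open>y\<^sup>2\<close> is at most \<open>h\<^sup>2\<close> times the square of the number of grid points below
  \<open>y\<close>, and that square is the sum of the odd numbers. The truncation at \<open>J * h\<close> makes it an
  induction.
\<close>
lemma square_le_layers:
  fixes h y :: real
  assumes "h > 0" "y \<ge> 0"
  shows "(min (real J * h) y)\<^sup>2 \<le> h\<^sup>2 * (\<Sum>j<J. real (2 * j + 1) * of_bool (real j * h < y))"
proof (induction J)
  case 0
  then show ?case using assms by simp
next
  case (Suc J)
  show ?case
  proof (cases "real J * h < y")
    case True
    have "(min (real (Suc J) * h) y)\<^sup>2 \<le> (real (Suc J) * h)\<^sup>2"
      using assms by (intro power_mono) auto
    also have "\<dots> = (real J * h)\<^sup>2 + h\<^sup>2 * real (2 * J + 1)"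
      by (simp add: power2_eq_square algebra_simps)
    also have "(real J * h)\<^sup>2 = (min (real J * h) y)\<^sup>2" using True by simp
    finally show ?thesis using Suc True by (simp add: algebra_simps)
  next
    case False
    moreover have "real J * h \<le> real (Suc J) * h" using assms by simp
    ultimately have "min (real (Suc J) * h) y = min (real J * h) y" by linarith
    then show ?thesis using Suc False by simp
  qed
qed

text \<open>
  A tail that halves at each step of length \<open>h\<close> is geometric, and the weights \<open>2 j + 1\<close> of the layers
  sum to at most \<open>3\<close> against it.
\<close>
lemma second_moment_of_halving_tail:
  fixes f :: "'a \<Rightarrow> real"
  assumes B: "finite B" and h: "h > 0"
    and start: "2 * card {x\<in>B. M < f x} \<le> card B"
    and halve: "\<And>j::nat. 2 * card {x\<in>B. M + (real j + 1) * h < f x} \<le> card {x\<in>B. M + real j * h < f x}"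
  shows "(\<Sum>x\<in>B. (max 0 (f x - M))\<^sup>2) \<le> 3 * h\<^sup>2 * card B"
proof -
  define q where "q j = real (card {x\<in>B. M + real j * h < f x})" for j
  have q: "q j \<le> (1/2) ^ Suc j * card B" for j
  proof (induction j)
    case 0
    then show ?case using start unfolding q_def by simp
  next
    case (Suc j)
    have "2 * q (Suc j) \<le> q j"
      using halve[of j] unfolding q_def by (simp add: add.commute)
    then show ?case using Suc by simp
  qed
  obtain J :: nat where J: "\<And>x. x \<in> B \<Longrightarrow> f x - M \<le> real J * h"
  proof -
    obtain b where b: "\<And>x. x \<in> B \<Longrightarrow> f x - M \<le> b"
      using bdd_above_finite[of "(\<lambda>x. f x - M) ` B"] B by (auto simp: bdd_above_def)
    obtain J :: nat where "b / h < real J" using reals_Archimedean2 by blast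
    then have "b \<le> real J * h" using h by (simp add: divide_less_eq)
    then show ?thesis using b that by (meson order_trans)
  qed
  have "(\<Sum>x\<in>B. (max 0 (f x - M))\<^sup>2)
      \<le> (\<Sum>x\<in>B. h\<^sup>2 * (\<Sum>j<J. real (2 * j + 1) * of_bool (M + real j * h < f x)))"
  proof (rule sum_mono)
    fix x assume "x \<in> B"
    then have "min (real J * h) (max 0 (f x - M)) = max 0 (f x - M)"
      using J[of x] h by (intro min_absorb2) simp
    moreover have "of_bool (real j * h < max 0 (f x - M)) = (of_bool (M + real j * h < f x) :: real)" for j
      using h by (auto simp: less_max_iff_disj mult_less_0_iff)
    ultimately show "(max 0 (f x - M))\<^sup>2
        \<le> h\<^sup>2 * (\<Sum>j<J. real (2 * j + 1) * of_bool (M + real j * h < f x))"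
      using square_le_layers[OF h, of "max 0 (f x - M)" J] by simp
  qed
  also have "\<dots> = h\<^sup>2 * (\<Sum>j<J. real (2 * j + 1) * q j)"
  proof -
    have "(\<Sum>x\<in>B. of_bool (M + real j * h < f x)) = q j" for j
      using B unfolding q_def by (simp add: Int_def)
    then show ?thesis
      unfolding sum_distrib_left[symmetric]
      by (subst sum.swap) (simp only: sum_distrib_left[symmetric])
  qed
  also have "\<dots> \<le> h\<^sup>2 * (\<Sum>j<J. real (2 * j + 1) * ((1/2) ^ Suc j * card B))"
    by (intro mult_left_mono sum_mono q) auto
  also have "\<dots> = h\<^sup>2 * card B * (\<Sum>j<J. real (2 * j + 1) * (1/2) ^ Suc j)"
    by (simp add: sum_distrib_left mult_ac)
  also have "\<dots> \<le> h\<^sup>2 * card B * 3"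
    unfolding sum_weighted_tails by (intro mult_left_mono) auto
  finally show ?thesis by (simp add: mult_ac)
qed

text \<open>
  The contrapositive use of the splitting inequality. If it fails for a lower part of size \<open>u\<close> and an
  upper part of size \<open>v\<close>, then \<open>v < (sqrt N - sqrt u)\<^sup>2\<close>. The right-hand side is quadratically small
  compared with the complement \<open>N - u\<close> of the lower part, and in particular at most half of it
  once \<open>u\<close> is at least half of \<open>N\<close>.
\<close>
lemma sqrt_deficit_halves:
  fixes N u v :: real
  assumes "0 \<le> v" "N \<le> 2 * u" "u \<le> N" "sqrt u + sqrt v < sqrt N"
  shows "2 * v \<le> N - u"
proof -
  have u: "0 \<le> u" "0 \<le> N" using assms by auto
  have "v = sqrt v * sqrt v" using assms by simp
  also have "\<dots> \<le> (sqrt N - sqrt u) * (sqrt N - sqrt u)"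
    using assms by (intro mult_mono) auto
  finally have 1: "v \<le> (sqrt N - sqrt u) * (sqrt N - sqrt u)" .
  have "sqrt N \<le> sqrt (9 * u)" using assms u by simp
  also have "\<dots> = 3 * sqrt u" by (simp add: real_sqrt_mult)
  finally have "(sqrt N - sqrt u) * (2 * (sqrt N - sqrt u)) \<le> (sqrt N - sqrt u) * (sqrt N + sqrt u)"
    using assms u by (intro mult_left_mono) auto
  also have "\<dots> = N - u" using u by (simp add: algebra_simps)
  finally show ?thesis using 1 by linarith
qed

lemma obtain_int_first_true:
  fixes P :: "int \<Rightarrow> bool"
  assumes "P k1" "\<And>k. k \<le> k2 \<Longrightarrow> \<not> P k"
  obtains k where "P k" "\<not> P (k - 1)"
proof -
  have "k2 < k1" using assms not_le by blast
  then have "P (k2 + int (nat (k1 - k2)))" using assms by simp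
  define m where "m = (LEAST m. P (k2 + int m))"
  have m: "P (k2 + int m)" unfolding m_def by (rule LeastI) fact
  then have "m \<noteq> 0" using assms(2)[of k2] by (intro notI) simp
  then have "\<not> P (k2 + int (m - 1))" unfolding m_def by (metis diff_less not_less_Least zero_less_one gr0I)
  moreover have "k2 + int (m - 1) = k2 + int m - 1" using \<open>m \<noteq> 0\<close> by simp
  ultimately show ?thesis using m that by metis
qed

text \<open>
  Suppose that no level splits \<open>B\<close>. Walking upwards from a grid median \<open>M\<close>, each step halves the number
  of points above, and walking downwards from the preceding level each step halves the number of points
  below. Both one-sided second moments around \<open>M\<close> are therefore at most \<open>3 h\<^sup>2\<close> per point, which bounds
  the mean of \<open>(f x - M)\<^sup>2\<close> by \<open>11 h\<^sup>2\<close> and the mean of \<open>(f x - f y)\<^sup>2\<close> by \<open>44 h\<^sup>2\<close>. The two parts are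
  required to be nonempty because a level below or above all values satisfies the inequality trivially.
\<close>
lemma separating_level:
  fixes f :: "'a \<Rightarrow> real"
  assumes B: "finite B" and h: "h > 0"
    and spread: "(\<Sum>x\<in>B. \<Sum>y\<in>B. (f x - f y)\<^sup>2) > 44 * h\<^sup>2 * (real (card B))\<^sup>2"
  shows "\<exists>k::int. {x\<in>B. f x \<le> real_of_int k * h} \<noteq> {} \<and> {x\<in>B. (real_of_int k + 1) * h \<le> f x} \<noteq> {} \<and>
    sqrt (card B) \<le> sqrt (card {x\<in>B. f x \<le> real_of_int k * h}) + sqrt (card {x\<in>B. (real_of_int k + 1) * h \<le> f x})"
proof (rule ccontr)
  assume contra: "\<not> ?thesis"
  define N where "N = card B"
  define lo where "lo k = card {x\<in>B. f x \<le> real_of_int k * h}" for k :: int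
  define hi where "hi k = card {x\<in>B. (real_of_int k + 1) * h \<le> f x}" for k :: int
  have "B \<noteq> {}" using spread by auto
  then have N: "N > 0" using B by (simp add: N_def card_gt_0_iff)
  have no: "lo k = 0 \<or> hi k = 0 \<or> sqrt (lo k) + sqrt (hi k) < sqrt N" for k
  proof -
    have e: "(lo k = 0) = ({x\<in>B. f x \<le> real_of_int k * h} = {})"
      "(hi k = 0) = ({x\<in>B. (real_of_int k + 1) * h \<le> f x} = {})"
      unfolding lo_def hi_def using B by (subst card_0_eq; simp)+
    show ?thesis
      using contra[unfolded not_ex, THEN spec[of _ k]]
      unfolding e unfolding lo_def hi_def N_def not_le[symmetric] by argo
  qed
  have above: "card {x\<in>B. real_of_int k * h < f x} = N - lo k" for k
  proof -
    have "{x\<in>B. real_of_int k * h < f x} = B - {x\<in>B. f x \<le> real_of_int k * h}" by auto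
    then show ?thesis using B by (simp add: card_Diff_subset N_def lo_def)
  qed
  have below: "card {x\<in>B. f x < (real_of_int k + 1) * h} = N - hi k" for k
  proof -
    have "{x\<in>B. f x < (real_of_int k + 1) * h} = B - {x\<in>B. (real_of_int k + 1) * h \<le> f x}" by auto
    then show ?thesis using B by (simp add: card_Diff_subset N_def hi_def)
  qed
  have lehi: "lo k \<le> N" "hi k \<le> N" for k
    using B by (auto simp: lo_def hi_def N_def intro!: card_mono)
  have lo_mono: "lo k \<le> lo l" if "k \<le> l" for k l
    unfolding lo_def using B h that
    by (intro card_mono) (auto elim!: order_trans intro!: mult_right_mono)
  have hi_mono: "hi l \<le> hi k" if "k \<le> l" for k l
    unfolding hi_def using B h that
    by (intro card_mono) (auto elim!: order_trans[rotated] intro!: mult_right_mono)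
  have lohi: "lo k + hi k \<le> N" for k
  proof -
    have "lo k + hi k = card ({x\<in>B. f x \<le> real_of_int k * h} \<union> {x\<in>B. (real_of_int k + 1) * h \<le> f x})"
      unfolding lo_def hi_def using B h by (subst card_Un_disjoint) (auto simp: algebra_simps)
    also have "\<dots> \<le> N" unfolding N_def using B by (intro card_mono) auto
    finally show ?thesis .
  qed
  obtain b where b: "\<And>x. x \<in> B \<Longrightarrow> \<bar>f x\<bar> \<le> b"
    using bdd_above_finite[of "(\<lambda>x. \<bar>f x\<bar>) ` B"] B by (auto simp: bdd_above_def)
  \<comment> \<open>The first grid level that has at least half of the values below it.\<close>
  obtain k0 where k0: "N \<le> 2 * lo k0" "\<not> N \<le> 2 * lo (k0 - 1)"
  proof (rule obtain_int_first_true)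
    have "{x\<in>B. f x \<le> \<lceil>b / h\<rceil> * h} = B"
    proof -
      have "b \<le> \<lceil>b / h\<rceil> * h" using h by (metis le_of_int_ceiling pos_divide_le_eq)
      then show ?thesis using b by (auto) (smt (verit))
    qed
    then show "N \<le> 2 * lo \<lceil>b / h\<rceil>" by (simp add: lo_def N_def)
  next
    fix k :: int assume "k \<le> \<lfloor>- b / h\<rfloor> - 1"
    then have "real_of_int k < - b / h" by linarith
    then have "real_of_int k * h < - b" using h by (simp only: pos_less_divide_eq)
    then have "{x\<in>B. f x \<le> real_of_int k * h} = {}" using b by (auto) (smt (verit))
    then have "lo k = 0" unfolding lo_def by (simp only: card.empty)
    then show "\<not> N \<le> 2 * lo k" using N by simp
  qed
  define M where "M = real_of_int k0 * h"
  have up: "(\<Sum>x\<in>B. (max 0 (f x - M))\<^sup>2) \<le> 3 * h\<^sup>2 * card B"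
  proof (rule second_moment_of_halving_tail[OF B h])
    show "2 * card {x\<in>B. M < f x} \<le> card B"
      using above[of k0] k0 lehi[of k0] by (simp add: M_def N_def)
    fix j :: nat
    have k: "N \<le> 2 * lo (k0 + j)" using k0 lo_mono[of k0 "k0 + j"] by simp
    have "card {x\<in>B. M + (real j + 1) * h < f x} \<le> hi (k0 + j)"
      unfolding hi_def M_def using B by (intro card_mono) (auto simp: algebra_simps)
    moreover have "2 * hi (k0 + j) \<le> N - lo (k0 + j)"
    proof (cases "hi (k0 + j) = 0")
      case False
      then have "2 * real (hi (k0 + j)) \<le> real N - real (lo (k0 + j))"
        using no[of "k0 + j"] k N lehi by (intro sqrt_deficit_halves) auto
      then show ?thesis by linarith
    qed simp
    moreover have "card {x\<in>B. M + real j * h < f x} = N - lo (k0 + j)"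
      using above[of "k0 + j"] by (simp add: M_def algebra_simps)
    ultimately show "2 * card {x\<in>B. M + (real j + 1) * h < f x} \<le> card {x\<in>B. M + real j * h < f x}"
      by linarith
  qed
  have down: "(\<Sum>x\<in>B. (max 0 (- f x - (h - M)))\<^sup>2) \<le> 3 * h\<^sup>2 * card B"
  proof (rule second_moment_of_halving_tail[OF B h])
    have "card {x\<in>B. h - M < - f x} \<le> lo (k0 - 1)"
      unfolding lo_def M_def using B by (intro card_mono) (auto simp: algebra_simps)
    then show start: "2 * card {x\<in>B. h - M < - f x} \<le> card B"
      using k0 by (simp add: N_def)
    fix j :: nat
    define k where "k = k0 - 2 - int j"
    have eq: "card {x\<in>B. h - M + real j * h < - f x} = N - hi k"
    proof -
      have "{x\<in>B. h - M + real j * h < - f x} = {x\<in>B. f x < (real_of_int k + 1) * h}"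
        by (auto simp: M_def k_def algebra_simps)
      then show ?thesis using below by simp
    qed
    have "{x\<in>B. h - M + real j * h < - f x} \<subseteq> {x\<in>B. h - M < - f x}"
      using h by (auto simp: algebra_simps) (smt (verit) mult_nonneg_nonneg of_nat_0_le_iff)
    then have "card {x\<in>B. h - M + real j * h < - f x} \<le> card {x\<in>B. h - M < - f x}"
      using B by (intro card_mono) auto
    then have k': "N \<le> 2 * hi k" using eq start lehi[of k] by (simp add: N_def)
    have "card {x\<in>B. h - M + (real j + 1) * h < - f x} \<le> lo k"
      unfolding lo_def M_def k_def using B by (intro card_mono) (auto simp: algebra_simps)
    moreover have "2 * lo k \<le> N - hi k"
    proof (cases "lo k = 0")
      case False
      then have "2 * real (lo k) \<le> real N - real (hi k)"
        using no[of k] k' N lehi by (intro sqrt_deficit_halves) auto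
      then show ?thesis by linarith
    qed simp
    ultimately show "2 * card {x\<in>B. h - M + (real j + 1) * h < - f x} \<le> card {x\<in>B. h - M + real j * h < - f x}"
      using eq by linarith
  qed
  \<comment> \<open>The downward walk starts one level below the median, which costs the extra \<open>2 h\<^sup>2\<close>.\<close>
  have "(f x - M)\<^sup>2 \<le> (max 0 (f x - M))\<^sup>2 + (2 * h\<^sup>2 + 2 * (max 0 (- f x - (h - M)))\<^sup>2)" for x
  proof (cases "M \<le> f x")
    case False
    define w where "w = max 0 (- f x - (h - M))"
    have "(f x - M)\<^sup>2 = (M - f x)\<^sup>2" by (simp add: power2_commute)
    also have "\<dots> \<le> (h + w)\<^sup>2" using False by (intro power_mono) (auto simp: w_def)
    also have "\<dots> \<le> 2 * h\<^sup>2 + 2 * w\<^sup>2"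
      using sum_squares_bound[of h w] by (simp add: power2_sum)
    finally show ?thesis using False by (simp add: w_def)
  qed auto
  then have "(\<Sum>x\<in>B. (f x - M)\<^sup>2)
      \<le> (\<Sum>x\<in>B. (max 0 (f x - M))\<^sup>2 + (2 * h\<^sup>2 + 2 * (max 0 (- f x - (h - M)))\<^sup>2))"
    by (intro sum_mono)
  also have "\<dots> = (\<Sum>x\<in>B. (max 0 (f x - M))\<^sup>2) + 2 * h\<^sup>2 * N
      + 2 * (\<Sum>x\<in>B. (max 0 (- f x - (h - M)))\<^sup>2)"
    by (simp add: sum.distrib sum_distrib_left N_def)
  finally have second: "(\<Sum>x\<in>B. (f x - M)\<^sup>2) \<le> 11 * h\<^sup>2 * N"
    using up down by (simp add: N_def)
  have "(f x - f y)\<^sup>2 \<le> 2 * (f x - M)\<^sup>2 + 2 * (f y - M)\<^sup>2" for x y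
    using sum_squares_bound[of "f x - M" "- (f y - M)"] 
    by (simp add: power2_eq_square algebra_simps)
  then have "(\<Sum>x\<in>B. \<Sum>y\<in>B. (f x - f y)\<^sup>2) \<le> (\<Sum>x\<in>B. \<Sum>y\<in>B. 2 * (f x - M)\<^sup>2 + 2 * (f y - M)\<^sup>2)"
    by (intro sum_mono)
  also have "\<dots> = 4 * N * (\<Sum>x\<in>B. (f x - M)\<^sup>2)"
    by (simp add: sum.distrib sum_distrib_left[symmetric] N_def)
  also have "\<dots> \<le> 4 * N * (11 * h\<^sup>2 * N)" using second by (intro mult_left_mono) auto
  finally show False using spread by (simp add: N_def power2_eq_square mult_ac)
qed


section \<open>Counting shattered families of levels\<close>

text \<open>
  A set of coordinates together with a grid level for each of them is encoded as one partial map, so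
  that such families can be counted and extended by a coordinate with a map update. The gap between
  \<open>k * h\<close> and \<open>(k + 1) * h\<close> is the side of the cube obtained later. Letting \<open>\<epsilon>\<close> range over all sets instead
  of subsets of \<open>dom \<kappa>\<close> changes nothing, as only \<open>\<epsilon> \<inter> dom \<kappa>\<close> matters.
\<close>
definition shatters :: "real \<Rightarrow> ('i \<Rightarrow> real) set \<Rightarrow> ('i \<rightharpoonup> int) \<Rightarrow> bool" where
  "shatters h A \<kappa> \<longleftrightarrow> (\<forall>\<epsilon>. \<exists>x\<in>A. \<forall>i k. \<kappa> i = Some k \<longrightarrow>
     (if i \<in> \<epsilon> then (real_of_int k + 1) * h \<le> x i else x i \<le> real_of_int k * h))"

lemma shatters_mono: "shatters h A \<kappa> \<Longrightarrow> A \<subseteq> B \<Longrightarrow> shatters h B \<kappa>"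
  unfolding shatters_def by (meson subsetD)

lemma shatters_empty_map: "A \<noteq> {} \<Longrightarrow> shatters h A Map.empty"
  unfolding shatters_def by auto

lemma shatters_levels:
  assumes "shatters h A \<kappa>" "\<kappa> i = Some k"
  obtains x y where "x \<in> A" "x i \<le> real_of_int k * h" "y \<in> A" "(real_of_int k + 1) * h \<le> y i"
proof -
  obtain x where "x \<in> A" "\<forall>i k. \<kappa> i = Some k \<longrightarrow>
     (if i \<in> {} then (real_of_int k + 1) * h \<le> x i else x i \<le> real_of_int k * h)"
    using assms(1) unfolding shatters_def by blast
  moreover obtain y where "y \<in> A" "\<forall>i k. \<kappa> i = Some k \<longrightarrow>
     (if i \<in> UNIV then (real_of_int k + 1) * h \<le> y i else y i \<le> real_of_int k * h)"
    using assms(1) unfolding shatters_def by blast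
  ultimately show ?thesis using assms(2) that by auto
qed

lemma shatters_split:
  assumes lo: "shatters h {x\<in>A. x i \<le> real_of_int k * h} \<kappa>"
    and hi: "shatters h {x\<in>A. (real_of_int k + 1) * h \<le> x i} \<kappa>"
  shows "shatters h A (\<kappa>(i \<mapsto> k))"
  unfolding shatters_def
proof
  fix \<epsilon>
  show "\<exists>x\<in>A. \<forall>j l. (\<kappa>(i \<mapsto> k)) j = Some l \<longrightarrow>
     (if j \<in> \<epsilon> then (real_of_int l + 1) * h \<le> x j else x j \<le> real_of_int l * h)"
  proof (cases "i \<in> \<epsilon>")
    case True
    obtain x where "x \<in> {x\<in>A. (real_of_int k + 1) * h \<le> x i}" "\<forall>j l. \<kappa> j = Some l \<longrightarrow>
       (if j \<in> \<epsilon> then (real_of_int l + 1) * h \<le> x j else x j \<le> real_of_int l * h)"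
      using hi unfolding shatters_def by blast
    then show ?thesis using True by (intro bexI[of _ x]) auto
  next
    case False
    obtain x where "x \<in> {x\<in>A. x i \<le> real_of_int k * h}" "\<forall>j l. \<kappa> j = Some l \<longrightarrow>
       (if j \<in> \<epsilon> then (real_of_int l + 1) * h \<le> x j else x j \<le> real_of_int l * h)"
      using lo unfolding shatters_def by blast
    then show ?thesis using False by (intro bexI[of _ x]) auto
  qed
qed

text \<open>
  A counting version of the Sauer-Shelah argument, along the tree of successive splittings. Let \<open>A\<close> be
  split into \<open>L\<close> and \<open>U\<close> at coordinate \<open>i\<close> and level \<open>k\<close>. Whatever one half shatters, \<open>A\<close> shatters, and a
  family shattered by both halves can be extended by \<open>i \<mapsto> k\<close>. So \<open>A\<close> shatters at least as many families as
  \<open>L\<close> and \<open>U\<close> together, and the subadditivity of \<open>sqrt (card _)\<close> in the splitting hypothesis is exactly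
  what carries the bound up the tree.
\<close>
lemma sqrt_card_le_card_shattered:
  fixes A :: "('i \<Rightarrow> real) set"
  assumes h: "h > 0" and "finite A" "A \<noteq> {}"
    and "finite {\<kappa>. dom \<kappa> \<subseteq> T \<and> shatters h A \<kappa>}"
    and "\<And>B. B \<subseteq> A \<Longrightarrow> 2 \<le> card B \<Longrightarrow> \<exists>i\<in>T. \<exists>k::int.
       {x\<in>B. x i \<le> real_of_int k * h} \<noteq> {} \<and> {x\<in>B. (real_of_int k + 1) * h \<le> x i} \<noteq> {} \<and>
       sqrt (card B) \<le> sqrt (card {x\<in>B. x i \<le> real_of_int k * h}) + sqrt (card {x\<in>B. (real_of_int k + 1) * h \<le> x i})"
  shows "sqrt (card A) \<le> card {\<kappa>. dom \<kappa> \<subseteq> T \<and> shatters h A \<kappa>}"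
  using assms(2-)
proof (induction "card A" arbitrary: A rule: less_induct)
  case less
  define Sh where "Sh B = {\<kappa>. dom \<kappa> \<subseteq> T \<and> shatters h B \<kappa>}" for B
  show ?case
  proof (cases "2 \<le> card A")
    case False
    moreover have "card A > 0" using less.prems by (simp add: card_gt_0_iff)
    ultimately have "card A = 1" by linarith
    moreover have "card (Sh A) > 0"
      using less.prems(3) shatters_empty_map[OF less.prems(2)]
      unfolding Sh_def by (intro card_gt_0_iff[THEN iffD2]) auto
    ultimately show ?thesis by (simp add: Sh_def)
  next
    case True
    obtain i and k :: int where i: "i \<in> T"
      and ne: "{x\<in>A. x i \<le> real_of_int k * h} \<noteq> {}" "{x\<in>A. (real_of_int k + 1) * h \<le> x i} \<noteq> {}"
      and sq: "sqrt (card A) \<le> sqrt (card {x\<in>A. x i \<le> real_of_int k * h}) + sqrt (card {x\<in>A. (real_of_int k + 1) * h \<le> x i})"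
      using less.prems(4)[OF subset_refl True] by (elim bexE exE conjE)
    define L where "L = {x\<in>A. x i \<le> real_of_int k * h}"
    define U where "U = {x\<in>A. (real_of_int k + 1) * h \<le> x i}"
    have sub: "L \<subseteq> A" "U \<subseteq> A" by (auto simp: L_def U_def)
    have disj: "L \<inter> U = {}" using h by (auto simp: L_def U_def algebra_simps)
    have smaller: "card L < card A" "card U < card A"
    proof -
      have "L \<noteq> {}" "U \<noteq> {}" using ne by (simp_all only: L_def U_def not_False_eq_True)
      then have "L \<subset> A" "U \<subset> A" using sub disj by blast+
      then show "card L < card A" "card U < card A"
        using less.prems(1) by (simp_all add: psubset_card_mono)
    qed
    have Sh_sub: "Sh L \<subseteq> Sh A" "Sh U \<subseteq> Sh A"
      unfolding Sh_def using shatters_mono sub by blast+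
    have finSh: "finite (Sh L)" "finite (Sh U)" "finite (Sh A)"
      using less.prems(3) Sh_sub finite_subset unfolding Sh_def by blast+
    have IH: "sqrt (card B) \<le> card (Sh B)" if "B \<in> {L, U}" for B
      unfolding Sh_def
    proof (rule less.hyps)
      show "card B < card A" using that smaller by blast
      show "B \<noteq> {}" using that ne unfolding L_def[symmetric] U_def[symmetric] by blast
      show "finite B" using that sub less.prems(1) finite_subset by blast
      show "finite {\<kappa>. dom \<kappa> \<subseteq> T \<and> shatters h B \<kappa>}"
        using that finSh unfolding Sh_def by blast
      fix D assume "D \<subseteq> B" "2 \<le> card D"
      moreover have "B \<subseteq> A" using that sub by auto
      ultimately show "\<exists>i\<in>T. \<exists>k::int.
         {x\<in>D. x i \<le> real_of_int k * h} \<noteq> {} \<and> {x\<in>D. (real_of_int k + 1) * h \<le> x i} \<noteq> {} \<and>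
         sqrt (card D) \<le> sqrt (card {x\<in>D. x i \<le> real_of_int k * h}) + sqrt (card {x\<in>D. (real_of_int k + 1) * h \<le> x i})"
        by (intro less.prems(4)) auto
    qed
    \<comment> \<open>No level at \<open>i\<close> can be crossed by both halves, which lie on different sides of the gap at \<open>k\<close>.
      So the extension by \<open>i \<mapsto> k\<close> never overwrites a level, and it is injective.\<close>
    have no_i: "\<kappa> i = None" if \<kappa>: "\<kappa> \<in> Sh L" "\<kappa> \<in> Sh U" for \<kappa>
    proof (rule ccontr)
      assume "\<kappa> i \<noteq> None"
      then obtain l where l: "\<kappa> i = Some l" by blast
      obtain y where "y \<in> L" "(real_of_int l + 1) * h \<le> y i"
        using \<kappa>(1) l unfolding Sh_def by (blast elim: shatters_levels)
      then have "(real_of_int l + 1) * h \<le> real_of_int k * h" by (auto simp: L_def)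
      then have "real_of_int l + 1 \<le> real_of_int k" using h by simp
      moreover obtain x where "x \<in> U" "x i \<le> real_of_int l * h"
        using \<kappa>(2) l unfolding Sh_def by (blast elim: shatters_levels)
      then have "(real_of_int k + 1) * h \<le> real_of_int l * h" by (auto simp: U_def)
      then have "real_of_int k + 1 \<le> real_of_int l" using h by simp
      ultimately show False by linarith
    qed
    define E where "E = (\<lambda>\<kappa>. \<kappa>(i \<mapsto> k)) ` (Sh L \<inter> Sh U)"
    have "inj_on (\<lambda>\<kappa>. \<kappa>(i \<mapsto> k)) (Sh L \<inter> Sh U)"
    proof (rule inj_onI)
      fix \<kappa> \<kappa>' assume "\<kappa> \<in> Sh L \<inter> Sh U" "\<kappa>' \<in> Sh L \<inter> Sh U" "\<kappa>(i \<mapsto> k) = \<kappa>'(i \<mapsto> k)"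
      then show "\<kappa> = \<kappa>'" using no_i by (metis Int_iff fun_upd_triv fun_upd_upd)
    qed
    then have cardE: "card E = card (Sh L \<inter> Sh U)" unfolding E_def by (rule card_image)
    \<comment> \<open>Neither half alone crosses the gap at \<open>k\<close>, so the extensions are counted for the first time.\<close>
    have E_new: "E \<inter> (Sh L \<union> Sh U) = {}"
    proof -
      have "\<kappa>(i \<mapsto> k) \<notin> Sh L" for \<kappa>
      proof
        assume "\<kappa>(i \<mapsto> k) \<in> Sh L"
        then obtain y where "y \<in> L" "(real_of_int k + 1) * h \<le> y i"
          unfolding Sh_def by (metis (no_types, lifting) mem_Collect_eq shatters_levels fun_upd_same)
        then show False using disj by (auto simp: L_def U_def)
      qed
      moreover have "\<kappa>(i \<mapsto> k) \<notin> Sh U" for \<kappa>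
      proof
        assume "\<kappa>(i \<mapsto> k) \<in> Sh U"
        then obtain x where "x \<in> U" "x i \<le> real_of_int k * h"
          unfolding Sh_def by (metis (no_types, lifting) mem_Collect_eq shatters_levels fun_upd_same)
        then show False using disj by (auto simp: L_def U_def)
      qed
      ultimately show ?thesis by (auto simp: E_def)
    qed
    have "E \<subseteq> Sh A"
    proof
      fix \<kappa>' assume "\<kappa>' \<in> E"
      then obtain \<kappa> where \<kappa>: "\<kappa> \<in> Sh L" "\<kappa> \<in> Sh U" "\<kappa>' = \<kappa>(i \<mapsto> k)" by (auto simp: E_def)
      then have "shatters h A \<kappa>'"
        using shatters_split[of h A i k \<kappa>] by (simp add: Sh_def L_def U_def)
      moreover have "dom \<kappa>' \<subseteq> T" using \<kappa> i by (auto simp: Sh_def)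
      ultimately show "\<kappa>' \<in> Sh A" by (simp add: Sh_def)
    qed
    then have "card (E \<union> (Sh L \<union> Sh U)) \<le> card (Sh A)"
      using Sh_sub finSh by (intro card_mono) auto
    moreover have "card (E \<union> (Sh L \<union> Sh U)) = card E + card (Sh L \<union> Sh U)"
      using E_new finSh by (intro card_Un_disjoint) (auto simp: E_def)
    moreover have "card (Sh L) + card (Sh U) = card (Sh L \<union> Sh U) + card (Sh L \<inter> Sh U)"
      using finSh by (intro card_Un_Int) auto
    ultimately have "card (Sh L) + card (Sh U) \<le> card (Sh A)" using cardE by linarith
    moreover have "sqrt (card A) \<le> card (Sh L) + card (Sh U)"
      using sq IH[of L] IH[of U] unfolding L_def[symmetric] U_def[symmetric] by simp
    ultimately show ?thesis unfolding Sh_def by linarith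
  qed
qed

text \<open>
  Each point of \<open>T\<close> is either left out or receives one of the \<open>card P\<close> values at the price \<open>l\<close>. The weight
  is what makes the count of maps with small domain convenient: a map with at most \<open>d\<close> points has weight at
  least \<open>l ^ d\<close> if \<open>l \<le> 1\<close>, and \<open>l\<close> remains free to be chosen.
\<close>
lemma weighted_count_partial_maps:
  fixes l :: real
  assumes "finite T" "finite P"
  shows "finite {\<kappa>. dom \<kappa> \<subseteq> T \<and> ran \<kappa> \<subseteq> P} \<and>
    (\<Sum>\<kappa> | dom \<kappa> \<subseteq> T \<and> ran \<kappa> \<subseteq> P. l ^ card (dom \<kappa>)) = (1 + l * card P) ^ card T"
  using assms(1)
proof (induction T rule: finite_induct)
  case empty
  have "{\<kappa> :: 'a \<rightharpoonup> 'b. dom \<kappa> \<subseteq> {} \<and> ran \<kappa> \<subseteq> P} = {Map.empty}" by auto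
  then show ?case by simp
next
  case (insert i T)
  define F where "F = {\<kappa>. dom \<kappa> \<subseteq> T \<and> ran \<kappa> \<subseteq> P}"
  have F: "finite F" "(\<Sum>\<kappa>\<in>F. l ^ card (dom \<kappa>)) = (1 + l * card P) ^ card T"
    using insert.IH unfolding F_def by auto
  have F_i: "\<kappa> i = None" if "\<kappa> \<in> F" for \<kappa>
    using that insert.hyps(2) by (auto simp: F_def)
  define G where "G = (\<lambda>(\<kappa>, k). \<kappa>(i \<mapsto> k)) ` (F \<times> P)"
  have eq: "{\<kappa>. dom \<kappa> \<subseteq> insert i T \<and> ran \<kappa> \<subseteq> P} = F \<union> G"
  proof (intro equalityI subsetI)
    fix \<kappa> assume \<kappa>: "\<kappa> \<in> {\<kappa>. dom \<kappa> \<subseteq> insert i T \<and> ran \<kappa> \<subseteq> P}"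
    show "\<kappa> \<in> F \<union> G"
    proof (cases "\<kappa> i")
      case None
      then show ?thesis using \<kappa> by (auto simp: F_def)
    next
      case (Some k)
      then have "\<kappa>(i := None) \<in> F" "k \<in> P"
        using \<kappa> by (auto simp: F_def ran_def split: if_splits)
      moreover have "\<kappa> = (\<kappa>(i := None))(i \<mapsto> k)" using Some by auto
      ultimately have "\<kappa> \<in> G" unfolding G_def by (intro image_eqI[of _ _ "(\<kappa>(i := None), k)"]) auto
      then show ?thesis by simp
    qed
  next
    fix \<kappa> assume "\<kappa> \<in> F \<union> G"
    then consider "\<kappa> \<in> F" | \<kappa>' k where "\<kappa>' \<in> F" "k \<in> P" "\<kappa> = \<kappa>'(i \<mapsto> k)"
      by (auto simp: G_def)
    then show "\<kappa> \<in> {\<kappa>. dom \<kappa> \<subseteq> insert i T \<and> ran \<kappa> \<subseteq> P}"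
    proof cases
      case 2
      have "ran \<kappa> \<subseteq> insert k (ran \<kappa>')" unfolding 2(3) by (auto simp: ran_def)
      then show ?thesis using 2 by (auto simp: F_def)
    qed (auto simp: F_def)
  qed
  have inj: "inj_on (\<lambda>(\<kappa>, k). \<kappa>(i \<mapsto> k)) (F \<times> P)"
  proof (rule inj_onI, clarify)
    fix \<kappa> \<kappa>' k k' assume *: "\<kappa> \<in> F" "\<kappa>' \<in> F" "\<kappa>(i \<mapsto> k) = \<kappa>'(i \<mapsto> k')"
    then have "\<kappa> = \<kappa>'" by (metis F_i fun_upd_triv fun_upd_upd)
    then show "\<kappa> = \<kappa>' \<and> k = k'" using * by (metis fun_upd_same option.inject)
  qed
  have "(\<Sum>\<kappa>\<in>G. l ^ card (dom \<kappa>)) = (\<Sum>(\<kappa>, k)\<in>F \<times> P. l ^ card (dom (\<kappa>(i \<mapsto> k))))"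
    unfolding G_def by (subst sum.reindex[OF inj]) (auto intro!: sum.cong)
  also have "\<dots> = (\<Sum>(\<kappa>, k)\<in>F \<times> P. l * l ^ card (dom \<kappa>))"
  proof (intro sum.cong refl, clarify)
    fix \<kappa> k assume \<kappa>: "\<kappa> \<in> F"
    have "i \<notin> dom \<kappa>" using F_i[OF \<kappa>] by auto
    moreover have "dom \<kappa> \<subseteq> T" using \<kappa> by (simp add: F_def)
    moreover from this have "finite (dom \<kappa>)" using insert.hyps(1) finite_subset by blast
    ultimately
show "l ^ card (dom (\<kappa>(i \<mapsto> k))) = l * l ^ card (dom \<kappa>)" by simp
  qed
  also have "\<dots> = card P * l * (\<Sum>\<kappa>\<in>F. l ^ card (dom \<kappa>))"
    by (simp add: sum.cartesian_product[symmetric] sum_distrib_left mult_ac)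
  finally have G: "(\<Sum>\<kappa>\<in>G. l ^ card (dom \<kappa>)) = card P * l * (\<Sum>\<kappa>\<in>F. l ^ card (dom \<kappa>))" .
  have "finite G" using F assms(2) by (simp add: G_def)
  moreover have "F \<inter> G = {}"
  proof -
    have "\<kappa> i \<noteq> None" if "\<kappa> \<in> G" for \<kappa> using that by (auto simp: G_def)
    then show ?thesis using F_i by blast
  qed
  ultimately show ?case
    unfolding eq using F insert.hyps
    by (simp add: sum.union_disjoint G algebra_simps)
qed


section \<open>Entropy of separated sets\<close>
lemma exp_minus_le: "exp (- v) \<le> 1 - v / 2" if "0 \<le> v" "v \<le> 1" for v :: real
proof -
  have "v * v \<le> v" using that mult_left_le by blast
  then have "1 \<le> (1 - v / 2) * (1 + v)" by (simp add: algebra_simps)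
  also have "\<dots> \<le> (1 - v / 2) * exp v"
    using that by (intro mult_left_mono) auto
  finally show ?thesis by (simp add: exp_minus inverse_eq_divide divide_le_eq)
qed

text \<open>
  The first moment method for \<open>m\<close> coordinates drawn independently and uniformly, written as a sum
  over all choices \<open>\<iota>\<close>. For a fixed pair of points the variables \<open>u p (\<iota> j)\<close>, one quarter of the squared
  differences, lie in \<open>[0, 1]\<close> and have mean at least \<open>t\<^sup>2 / 4\<close>. So the exponential moment of minus their sum
  is at most \<open>exp (- m t\<^sup>2 / 8)\<close>, and by Markov's inequality the sum falls below \<open>m t\<^sup>2 / 16\<close> with
  probability at most \<open>exp (- m t\<^sup>2 / 16)\<close>. The hypothesis on \<open>m\<close> makes the union bound over
  the pairs smaller than \<open>1\<close>.
\<close>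
lemma few_coordinates_separate:
  fixes A :: "(nat \<Rightarrow> real) set"
  assumes n: "n \<ge> 1" and A: "finite A" "A \<noteq> {}"
    and bounded: "\<forall>x\<in>A. \<forall>i<n. \<bar>x i\<bar> \<le> 1"
    and sep: "\<forall>x\<in>A. \<forall>y\<in>A. x \<noteq> y \<longrightarrow> t\<^sup>2 * real n \<le> (\<Sum>i<n. (x i - y i)\<^sup>2)"
    and m: "32 * ln (card A) < real m * t\<^sup>2"
  shows "\<exists>\<iota>\<in>{..<m} \<rightarrow>\<^sub>E {..<n}. \<forall>x\<in>A. \<forall>y\<in>A. x \<noteq> y \<longrightarrow> real m * t\<^sup>2 / 4 \<le> (\<Sum>j<m. (x (\<iota> j) - y (\<iota> j))\<^sup>2)"
proof (rule ccontr)
  assume contra: "\<not> ?thesis"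
  define Q where "Q = {p \<in> A \<times> A. fst p \<noteq> snd p}"
  define u where "u p i = (fst p i - snd p i)\<^sup>2 / 4" for p :: "(nat \<Rightarrow> real) \<times> (nat \<Rightarrow> real)" and i
  define w where "w p \<iota> = (\<Prod>j<m. exp (- u p (\<iota> j)))" for p \<iota>
  have finQ: "finite Q" using A by (simp add: Q_def)
  have finI: "finite ({..<m} \<rightarrow>\<^sub>E {..<n})" by (simp add: finite_PiE)
  have pair: "(\<Sum>\<iota>\<in>{..<m} \<rightarrow>\<^sub>E {..<n}. w p \<iota>) \<le> real n ^ m * exp (- real m * t\<^sup>2 / 8)" if "p \<in> Q" for p
  proof -
    have u: "0 \<le> u p i" "u p i \<le> 1" if "i < n" for i
    proof -
      have "\<bar>fst p i - snd p i\<bar> \<le> 2"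
        using bounded[rule_format, of "fst p" i] bounded[rule_format, of "snd p" i] that \<open>p \<in> Q\<close>
        by (auto simp: Q_def)
      then show "u p i \<le> 1" using power_mono[of "\<bar>fst p i - snd p i\<bar>" 2 2] by (simp add: u_def)
    qed (simp add: u_def)
    have "(\<Sum>i<n. exp (- u p i)) \<le> (\<Sum>i<n. 1 - u p i / 2)"
      using u by (intro sum_mono exp_minus_le) auto
    also have "\<dots> = real n - (\<Sum>i<n. (fst p i - snd p i)\<^sup>2) / 8"
      by (simp add: u_def sum_subtractf sum_divide_distrib)
    also have "\<dots> \<le> real n * (1 + (- t\<^sup>2 / 8))"
      using sep[rule_format, of "fst p" "snd p"] that by (auto simp: Q_def algebra_simps)
    also have "\<dots> \<le> real n * exp (- t\<^sup>2 / 8)"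
      by (intro mult_left_mono exp_ge_add_one_self) auto
    finally have "(\<Sum>i<n. exp (- u p i)) ^ m \<le> (real n * exp (- t\<^sup>2 / 8)) ^ m"
      by (intro power_mono sum_nonneg) auto
    also have "\<dots> = real n ^ m * exp (- real m * t\<^sup>2 / 8)"
      by (simp add: power_mult_distrib exp_of_nat_mult[symmetric])
    also have "(\<Sum>i<n. exp (- u p i)) ^ m = (\<Sum>\<iota>\<in>{..<m} \<rightarrow>\<^sub>E {..<n}. w p \<iota>)"
      using prod_sum_PiE[of "{..<m}" "\<lambda>_. {..<n}" "\<lambda>_ i. exp (- u p i)"] by (simp add: w_def)
    finally show ?thesis .
  qed
  have "real n ^ m = (\<Sum>\<iota>\<in>{..<m} \<rightarrow>\<^sub>E {..<n}. 1)"
    by (simp add: card_PiE)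
  also have "\<dots> \<le> (\<Sum>\<iota>\<in>{..<m} \<rightarrow>\<^sub>E {..<n}. \<Sum>p\<in>Q. exp (real m * t\<^sup>2 / 16) * w p \<iota>)"
  proof (rule sum_mono)
    fix \<iota> assume \<iota>: "\<iota> \<in> {..<m} \<rightarrow>\<^sub>E {..<n}"
    then obtain x y where xy: "x \<in> A" "y \<in> A" "x \<noteq> y"
      "(\<Sum>j<m. (x (\<iota> j) - y (\<iota> j))\<^sup>2) < real m * t\<^sup>2 / 4"
      using contra by (meson not_le)
    have "0 \<le> real m * t\<^sup>2 / 16 - (\<Sum>j<m. (x (\<iota> j) - y (\<iota> j))\<^sup>2) / 4" using xy(4) by simp
    then have "1 \<le> exp (real m * t\<^sup>2 / 16 - (\<Sum>j<m. (x (\<iota> j) - y (\<iota> j))\<^sup>2) / 4)"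
      by (simp only: one_le_exp_iff)
    also have "\<dots> = exp (real m * t\<^sup>2 / 16) * w (x, y) \<iota>"
    proof -
      have "w (x, y) \<iota> = exp (\<Sum>j<m. - u (x, y) (\<iota> j))" unfolding w_def by (simp add: exp_sum)
      also have "(\<Sum>j<m. - u (x, y) (\<iota> j)) = - ((\<Sum>j<m. (x (\<iota> j) - y (\<iota> j))\<^sup>2) / 4)"
        by (simp add: u_def sum_negf sum_divide_distrib)
      finally show ?thesis by (simp add: exp_add[symmetric])
    qed
    also have "\<dots> \<le> (\<Sum>p\<in>Q. exp (real m * t\<^sup>2 / 16) * w p \<iota>)"
      using xy finQ by (intro member_le_sum) (auto simp: Q_def w_def prod_nonneg)
    finally show "1 \<le> (\<Sum>p\<in>Q. exp (real m * t\<^sup>2 / 16) * w p \<iota>)" .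
  qed
  also have "\<dots> = exp (real m * t\<^sup>2 / 16) * (\<Sum>p\<in>Q. \<Sum>\<iota>\<in>{..<m} \<rightarrow>\<^sub>E {..<n}. w p \<iota>)"
    by (subst sum.swap) (simp add: sum_distrib_left)
  also have "\<dots> \<le> exp (real m * t\<^sup>2 / 16) * (\<Sum>p\<in>Q. real n ^ m * exp (- real m * t\<^sup>2 / 8))"
    by (intro mult_left_mono sum_mono pair) auto
  also have "\<dots> = real n ^ m * (real (card Q) * exp (- (real m * t\<^sup>2 / 16)))"
    by (simp add: exp_add[symmetric] mult_ac)
  also have "\<dots> < real n ^ m * 1"
  proof (rule mult_strict_left_mono)
    have N: "real (card A) > 0" using A by (simp add: card_gt_0_iff)
    have "card Q \<le> card (A \<times> A)" unfolding Q_def using A by (intro card_mono) auto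
    then have "real (card Q) \<le> real (card A) * real (card A)"
      using A by (simp add: card_cartesian_product flip: of_nat_mult)
    also have "\<dots> = exp (2 * ln (card A))" using N by (simp add: exp_double power2_eq_square)
    also have "\<dots> < exp (real m * t\<^sup>2 / 16)" using m by simp
    finally have "real (card Q) * exp (- (real m * t\<^sup>2 / 16)) < exp (real m * t\<^sup>2 / 16) * exp (- (real m * t\<^sup>2 / 16))"
      by (rule mult_strict_right_mono) simp
    then show "real (card Q) * exp (- (real m * t\<^sup>2 / 16)) < 1" by (simp add: exp_minus)
  qed (use n in simp)
  finally show False by simp
qed

text \<open>
  In a separated set with at least two points at least half of the ordered pairs consist of distinct
  points. Averaging over the sampled coordinates gives a coordinate whose mean squared
  difference is at least \<open>t\<^sup>2 / 8\<close>, which exceeds the threshold \<open>44 (t/20)\<^sup>2\<close> of \<open>separating_level\<close>.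
\<close>
lemma separated_coordinate_level:
  fixes B :: "('i \<Rightarrow> real) set" and \<iota> :: "nat \<Rightarrow> 'i"
  assumes B: "finite B" "2 \<le> card B" and t: "t > 0" and m: "m > 0"
    and sep: "\<forall>x\<in>B. \<forall>y\<in>B. x \<noteq> y \<longrightarrow> real m * t\<^sup>2 / 4 \<le> (\<Sum>j<m. (x (\<iota> j) - y (\<iota> j))\<^sup>2)"
  shows "\<exists>i\<in>\<iota> ` {..<m}. \<exists>k::int.
     {x\<in>B. x i \<le> real_of_int k * (t / 20)} \<noteq> {} \<and> {x\<in>B. (real_of_int k + 1) * (t / 20) \<le> x i} \<noteq> {} \<and>
     sqrt (card B) \<le> sqrt (card {x\<in>B. x i \<le> real_of_int k * (t / 20)}) + sqrt (card {x\<in>B. (real_of_int k + 1) * (t / 20) \<le> x i})"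
proof -
  define N where "N = real (card B)"
  define D where "D i = (\<Sum>x\<in>B. \<Sum>y\<in>B. (x i - y i)\<^sup>2)" for i
  have N: "N \<ge> 2" using B by (simp add: N_def)
  have "(\<Sum>x\<in>B. \<Sum>y\<in>B. if x = y then 0 else real m * t\<^sup>2 / 4)
      \<le> (\<Sum>x\<in>B. \<Sum>y\<in>B. \<Sum>j<m. (x (\<iota> j) - y (\<iota> j))\<^sup>2)"
    using sep by (intro sum_mono) (auto simp: sum_nonneg)
  also have "\<dots> = (\<Sum>x\<in>B. \<Sum>j<m. \<Sum>y\<in>B. (x (\<iota> j) - y (\<iota> j))\<^sup>2)"
    by (intro sum.cong refl sum.swap)
  also have "\<dots> = (\<Sum>j<m. D (\<iota> j))" unfolding D_def by (rule sum.swap)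
  also have "(\<Sum>x\<in>B. \<Sum>y\<in>B. if x = y then 0 else real m * t\<^sup>2 / 4)
      = N * ((N - 1) * (real m * t\<^sup>2 / 4))"
  proof -
    have "(\<Sum>y\<in>B. if x = y then 0 else real m * t\<^sup>2 / 4) = (N - 1) * (real m * t\<^sup>2 / 4)" if "x \<in> B" for x
    proof -
      have "(\<Sum>y\<in>B. if x = y then 0 else real m * t\<^sup>2 / 4) = (\<Sum>y\<in>B - {x}. real m * t\<^sup>2 / 4)"
        using B by (intro sum.mono_neutral_cong_right) auto
      then show ?thesis using that B by (simp add: N_def of_nat_diff)
    qed
    then have "(\<Sum>x\<in>B. \<Sum>y\<in>B. if x = y then 0 else real m * t\<^sup>2 / 4) = (\<Sum>x\<in>B. (N - 1) * (real m * t\<^sup>2 / 4))"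
      by (intro sum.cong) auto
    then show ?thesis by (simp add: N_def)
  qed
  finally have big: "N * ((N - 1) * (real m * t\<^sup>2 / 4)) \<le> (\<Sum>j<m. D (\<iota> j))" .
  obtain j where j: "j < m" "N\<^sup>2 * t\<^sup>2 / 8 \<le> D (\<iota> j)"
  proof (rule ccontr)
    assume "\<not> thesis"
    then have "\<forall>j<m. D (\<iota> j) < N\<^sup>2 * t\<^sup>2 / 8" using that not_le by blast
    then have "(\<Sum>j<m. D (\<iota> j)) < (\<Sum>j<m. N\<^sup>2 * t\<^sup>2 / 8)"
      using m by (intro sum_strict_mono) auto
    also have "\<dots> = N * (N / 2 * (real m * t\<^sup>2 / 4))" by (simp add: power2_eq_square)
    also have "\<dots> \<le> N * ((N - 1) * (real m * t\<^sup>2 / 4))"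
      using N by (intro mult_left_mono mult_right_mono) auto
    finally show False using big by linarith
  qed
  have "44 * (t / 20)\<^sup>2 * N\<^sup>2 < N\<^sup>2 * t\<^sup>2 / 8"
    using N t by (simp add: power_divide divide_simps)
  then have "(\<Sum>x\<in>B. \<Sum>y\<in>B. (x (\<iota> j) - y (\<iota> j))\<^sup>2) > 44 * (t / 20)\<^sup>2 * (real (card B))\<^sup>2"
    using j(2) by (simp add: D_def N_def)
  from separating_level[OF B(1) _ this] show ?thesis using t j(1) by auto
qed

text \<open>
  Let \<open>N = card A\<close>, \<open>L = ln N\<close> and \<open>l = t ^ 3 / 6400\<close>. At most \<open>34 L / t\<^sup>2\<close> sampled coordinates and
  \<open>40 / t\<close> levels per coordinate are available, so all the partial maps together have weight at most
  \<open>exp (l * (34 L / t\<^sup>2) * (40 / t)) \<le> exp (L / 4)\<close>, whereas the shattered ones alone have weight at least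
  \<open>sqrt N * l ^ d = exp (L / 2) * l ^ d\<close>. The choice of \<open>l\<close> makes the first exponent smaller than \<open>L / 2\<close>, and
  what remains is a bound on \<open>L\<close> in terms of \<open>d\<close> and \<open>t\<close>.
\<close>
lemma card_separated_le:
  fixes A :: "(nat \<Rightarrow> real) set"
  assumes n: "n \<ge> 1" and A: "finite A" and t: "0 < t" "t \<le> 1"
    and bounded: "\<forall>x\<in>A. \<forall>i<n. \<bar>x i\<bar> \<le> 1"
    and sep: "\<forall>x\<in>A. \<forall>y\<in>A. x \<noteq> y \<longrightarrow> t\<^sup>2 * real n \<le> (\<Sum>i<n. (x i - y i)\<^sup>2)"
    and dim: "\<And>\<kappa>. dom \<kappa> \<subseteq> {..<n} \<Longrightarrow> shatters (t / 20) A \<kappa> \<Longrightarrow> card (dom \<kappa>) \<le> d"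
  shows "ln (card A) \<le> 52 * real d * ln (2 / t)"
proof (cases "2 \<le> card A")
  case False
  then have "card A = 0 \<or> card A = 1" by linarith
  then have "ln (card A) = 0" by auto
  then show ?thesis using t by simp
next
  case True
  define L where "L = ln (card A)"
  have "ln 2 \<le> L" using True unfolding L_def by simp
  then have L: "L \<ge> 1/2" using ln2_ge_two_thirds by linarith
  define m where "m = nat \<lfloor>32 * L / t\<^sup>2\<rfloor> + 1"
  have t2: "0 < t\<^sup>2" "t\<^sup>2 \<le> 1" using t by (auto simp: power_le_one)
  have q: "0 \<le> 32 * L / t\<^sup>2" using L by simp
  have "32 * L / t\<^sup>2 < real m" using q unfolding m_def by linarith
  then have m1: "32 * L < real m * t\<^sup>2" using t2 by (simp add: divide_less_eq)
  have "real m \<le> 32 * L / t\<^sup>2 + 1" using q unfolding m_def by linarith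
  also have "1 \<le> 2 * L / t\<^sup>2" using L t2 by (simp add: le_divide_eq)
  finally have m2: "real m \<le> 34 * L / t\<^sup>2" by (simp add: field_simps)
  have "A \<noteq> {}" using True by auto
  obtain \<iota> where \<iota>: "\<iota> \<in> {..<m} \<rightarrow>\<^sub>E {..<n}"
    and sep': "\<forall>x\<in>A. \<forall>y\<in>A. x \<noteq> y \<longrightarrow> real m * t\<^sup>2 / 4 \<le> (\<Sum>j<m. (x (\<iota> j) - y (\<iota> j))\<^sup>2)"
    using few_coordinates_separate[OF n A \<open>A \<noteq> {}\<close> bounded sep m1[unfolded L_def]] by blast
  define T where "T = \<iota> ` {..<m}"
  have T: "finite T" "T \<subseteq> {..<n}" using \<iota> by (auto simp: T_def)
  have cardT: "card T \<le> m" using card_image_le[of "{..<m}" \<iota>] by (simp add: T_def)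
  define P where "P = {- \<lfloor>20 / t\<rfloor>..<\<lfloor>20 / t\<rfloor>}"
  have cardP: "real (card P) \<le> 40 / t"
  proof -
    have "real (card P) = 2 * real_of_int \<lfloor>20 / t\<rfloor>" using t by (simp add: P_def)
    also have "\<dots> \<le> 2 * (20 / t)" by (intro mult_left_mono) auto
    finally show ?thesis by simp
  qed
  define S where "S = {\<kappa>. dom \<kappa> \<subseteq> T \<and> shatters (t / 20) A \<kappa>}"
  define F where "F = {\<kappa>. dom \<kappa> \<subseteq> T \<and> ran \<kappa> \<subseteq> P}"
  define l where "l = t ^ 3 / 6400"
  have l: "0 < l" "l \<le> 1"
    using t power_le_one[of t 3] by (auto simp: l_def)
  have F: "finite F" "(\<Sum>\<kappa>\<in>F. l ^ card (dom \<kappa>)) = (1 + l * card P) ^ card T"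
    using weighted_count_partial_maps[OF T(1), of P l] by (auto simp: F_def P_def)
  have SF: "S \<subseteq> F"
  proof
    fix \<kappa> assume \<kappa>: "\<kappa> \<in> S"
    have "k \<in> P" if k: "\<kappa> i = Some k" for i k
    proof -
      have i: "i < n" using k \<kappa> T(2) by (auto simp: S_def)
      obtain x y where xy: "x \<in> A" "x i \<le> real_of_int k * (t / 20)"
        "y \<in> A" "(real_of_int k + 1) * (t / 20) \<le> y i"
        using \<kappa> k unfolding S_def by (auto elim: shatters_levels)
      have "- 1 \<le> real_of_int k * (t / 20)" using bounded[rule_format, OF xy(1) i] xy(2) by linarith
      then have "- real_of_int k \<le> 20 / t" using t by (simp add: field_simps)
      moreover have "(real_of_int k + 1) * (t / 20) \<le> 1" using bounded[rule_format, OF xy(3) i] xy(4) by linarith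
      then have "real_of_int k + 1 \<le> 20 / t" using t by (simp add: field_simps)
      ultimately have "- k \<le> \<lfloor>20 / t\<rfloor>" "k + 1 \<le> \<lfloor>20 / t\<rfloor>" by (simp_all add: le_floor_iff)
      then show ?thesis by (simp add: P_def)
    qed
    then show "\<kappa> \<in> F" using \<kappa> by (auto simp: S_def F_def ran_def)
  qed
  have finS: "finite S" using SF F(1) finite_subset by blast
  have "m > 0" by (simp add: m_def)
  have "sqrt (card A) \<le> card S"
    unfolding S_def
  proof (rule sqrt_card_le_card_shattered)
    show "0 < t / 20" "finite A" "A \<noteq> {}" using t A True by auto
    show "finite {\<kappa>. dom \<kappa> \<subseteq> T \<and> shatters (t / 20) A \<kappa>}" using finS by (simp add: S_def)
    fix B assume B: "B \<subseteq> A" "2 \<le> card B"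
    have "finite B" using B A finite_subset by blast
    show "\<exists>i\<in>T. \<exists>k::int.
     {x\<in>B. x i \<le> real_of_int k * (t / 20)} \<noteq> {} \<and> {x\<in>B. (real_of_int k + 1) * (t / 20) \<le> x i} \<noteq> {} \<and>
     sqrt (card B) \<le> sqrt (card {x\<in>B. x i \<le> real_of_int k * (t / 20)}) + sqrt (card {x\<in>B. (real_of_int k + 1) * (t / 20) \<le> x i})"
      unfolding T_def
      by (rule separated_coordinate_level[OF \<open>finite B\<close> B(2) t(1) \<open>m > 0\<close>])
        (use sep' B(1) in blast)
  qed
  then have "sqrt (card A) * l ^ d \<le> (\<Sum>\<kappa>\<in>S. l ^ d)"
    using l by (simp add: mult_right_mono)
  also have "\<dots> \<le> (\<Sum>\<kappa>\<in>S. l ^ card (dom \<kappa>))"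
    using l dim T(2) by (intro sum_mono power_decreasing) (auto simp: S_def)
  also have "\<dots> \<le> (1 + l * card P) ^ card T"
    unfolding F(2)[symmetric] using l F(1) SF by (intro sum_mono2) auto
  also have "\<dots> \<le> (1 + l * card P) ^ m"
    using l cardT by (intro power_increasing) auto
  also have "\<dots> \<le> exp (l * card P) ^ m"
    using l by (intro power_mono exp_ge_add_one_self) auto
  also have "\<dots> = exp (real m * (l * card P))" by (simp add: exp_of_nat_mult)
  also have "\<dots> \<le> exp (L / 4)"
  proof -
    have "real m * (l * card P) \<le> (34 * L / t\<^sup>2) * (l * (40 / t))"
      using m2 cardP l L by (intro mult_mono) auto
    also have "\<dots> = 34 * 40 / 6400 * L"
      using t by (simp add: l_def power2_eq_square power3_eq_cube)
    also have "\<dots> \<le> L / 4" using L by simp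
    finally show ?thesis by simp
  qed
  finally have "ln (sqrt (card A) * l ^ d) \<le> ln (exp (L / 4))"
    using True l by (intro ln_mono) auto
  then have "L / 2 + real d * ln l \<le> L / 4"
    using True l by (simp add: ln_mult ln_sqrt ln_realpow L_def)
  then have "L \<le> 4 * real d * (- ln l)" by (simp add: algebra_simps)
  also have "\<dots> \<le> 4 * real d * (13 * ln (2 / t))"
  proof (intro mult_left_mono)
    have "- ln l = ln (6400 / t ^ 3)" using t by (simp add: l_def ln_div)
    also have "\<dots> \<le> ln ((2 / t) ^ 13)"
    proof (rule ln_mono)
      have "t ^ 13 \<le> t ^ 3" using t by (intro power_decreasing) auto
      then show "6400 / t ^ 3 \<le> (2 / t) ^ 13"
        unfolding power_divide using t by (intro frac_le) auto
    qed (use t in auto)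
    also have "\<dots> = 13 * ln (2 / t)" using t by (simp add: ln_realpow)
    finally show "- ln l \<le> 13 * ln (2 / t)" .
  qed auto
  finally show ?thesis by (simp add: L_def)
qed

section \<open>Shattered families and the combinatorial dimension\<close>
lemma shattered_imp_cube:
  assumes K: "coord_convex K" "A \<subseteq> K" and \<kappa>: "shatters h A \<kappa>" "finite (dom \<kappa>)"
  shows "(\<Pi>\<^sub>E i\<in>dom \<kappa>. {real_of_int (the (\<kappa> i)) * h .. real_of_int (the (\<kappa> i)) * h + h}) \<subseteq> coord_proj (dom \<kappa>) K"
proof
  fix z assume z: "z \<in> (\<Pi>\<^sub>E i\<in>dom \<kappa>. {real_of_int (the (\<kappa> i)) * h .. real_of_int (the (\<kappa> i)) * h + h})"
  have "\<exists>x\<in>K. \<forall>i\<in>dom \<kappa>. x i = z i"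
  proof (rule octants_imp_point)
    fix \<epsilon>
    obtain x where x: "x \<in> A" "\<forall>i k. \<kappa> i = Some k \<longrightarrow>
        (if i \<in> \<epsilon> then (real_of_int k + 1) * h \<le> x i else x i \<le> real_of_int k * h)"
      using \<kappa>(1) unfolding shatters_def by blast
    show "\<exists>x\<in>K. \<forall>i\<in>dom \<kappa>. if i \<in> \<epsilon> then z i \<le> x i else x i \<le> z i"
    proof (intro bexI ballI)
      fix i assume "i \<in> dom \<kappa>"
      then obtain k where k: "\<kappa> i = Some k" by blast
      then have "real_of_int k * h \<le> z i" "z i \<le> real_of_int k * h + h"
        using PiE_mem[OF z, of i] by auto
      moreover have "if i \<in> \<epsilon> then (real_of_int k + 1) * h \<le> x i else x i \<le> real_of_int k * h"
        using x(2) k by blast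
      ultimately show "if i \<in> \<epsilon> then z i \<le> x i else x i \<le> z i"
        by (auto simp: algebra_simps split: if_splits)
    qed (use x K in blast)
  qed (use K \<kappa> in auto)
  then obtain x where "x \<in> K" "\<forall>i\<in>dom \<kappa>. x i = z i" by blast
  moreover from this have "restrict x (dom \<kappa>) = z"
    using z by (intro ext) (auto simp: restrict_def PiE_def extensional_def)
  ultimately show "z \<in> coord_proj (dom \<kappa>) K" unfolding coord_proj_def by blast
qed

definition cube_index_sets :: "nat \<Rightarrow> (nat \<Rightarrow> real) set \<Rightarrow> real \<Rightarrow> nat set set" where
  "cube_index_sets n K t = {\<sigma>. \<sigma> \<subseteq> {..<n} \<and> \<sigma> \<noteq> {} \<and>
     (\<exists>x \<in> \<sigma> \<rightarrow>\<^sub>E UNIV. (\<Pi>\<^sub>E i\<in>\<sigma>. {x i .. x i + t}) \<subseteq> coord_proj \<sigma> K)}"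

lemma VC_eq: "VC n K t = Max (insert 0 (card ` cube_index_sets n K t))"
proof -
  have "{card \<sigma> |\<sigma>. \<sigma> \<subseteq> {..<n} \<and> \<sigma> \<noteq> {} \<and>
       (\<exists>x \<in> \<sigma> \<rightarrow>\<^sub>E UNIV. (\<Pi>\<^sub>E i\<in>\<sigma>. {x i .. x i + t}) \<subseteq> coord_proj \<sigma> K)} = card ` cube_index_sets n K t"
    unfolding cube_index_sets_def by blast
  then show ?thesis unfolding VC_def by simp
qed

lemma cube_index_setsI:
  assumes "\<sigma> \<subseteq> {..<n}" "\<sigma> \<noteq> {}" "x \<in> \<sigma> \<rightarrow>\<^sub>E UNIV" "(\<Pi>\<^sub>E i\<in>\<sigma>. {x i .. x i + t}) \<subseteq> coord_proj \<sigma> K"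
  shows "\<sigma> \<in> cube_index_sets n K t"
  unfolding cube_index_sets_def using assms by (intro CollectI conjI bexI[of _ x])

lemma finite_cube_index_sets: "finite (cube_index_sets n K t)"
  by (rule finite_subset[of _ "Pow {..<n}"]) (auto simp: cube_index_sets_def)

lemma card_le_VC: "\<sigma> \<in> cube_index_sets n K t \<Longrightarrow> card \<sigma> \<le> VC n K t"
  unfolding VC_eq using finite_cube_index_sets by (intro Max_ge) auto

lemma VC_le: "VC n K t \<le> n"
  unfolding VC_eq using finite_cube_index_sets subset_eq_atLeast0_lessThan_card
  by (auto simp: cube_index_sets_def atLeast0LessThan)

lemma VC_antimono: assumes "s \<le> t" shows "VC n K t \<le> VC n K s"
proof -
  have "cube_index_sets n K t \<subseteq> cube_index_sets n K s"
  proof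
    fix \<sigma> assume "\<sigma> \<in> cube_index_sets n K t"
    then obtain x where x: "x \<in> \<sigma> \<rightarrow>\<^sub>E UNIV" "(\<Pi>\<^sub>E i\<in>\<sigma>. {x i .. x i + t}) \<subseteq> coord_proj \<sigma> K"
      and \<sigma>: "\<sigma> \<subseteq> {..<n}" "\<sigma> \<noteq> {}"
      by (auto simp: cube_index_sets_def)
    have "(\<Pi>\<^sub>E i\<in>\<sigma>. {x i .. x i + s}) \<subseteq> (\<Pi>\<^sub>E i\<in>\<sigma>. {x i .. x i + t})"
      using assms by (intro PiE_mono) auto
    then have "(\<Pi>\<^sub>E i\<in>\<sigma>. {x i .. x i + s}) \<subseteq> coord_proj \<sigma> K" using x(2) by (rule subset_trans)
    with \<sigma> x(1) show "\<sigma> \<in> cube_index_sets n K s" by (rule cube_index_setsI)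
  qed
  then show ?thesis unfolding VC_eq using finite_cube_index_sets by (intro Max_mono) auto
qed

lemma card_dom_shattered_le_VC:
  assumes K: "coord_convex K" "A \<subseteq> K" and \<kappa>: "shatters h A \<kappa>" "dom \<kappa> \<subseteq> {..<n}"
  shows "card (dom \<kappa>) \<le> VC n K h"
proof (cases "dom \<kappa> = {}")
  case False
  have fin: "finite (dom \<kappa>)" using \<kappa>(2) finite_subset by blast
  let ?x = "\<lambda>i\<in>dom \<kappa>. real_of_int (the (\<kappa> i)) * h"
  have "(\<Pi>\<^sub>E i\<in>dom \<kappa>. {?x i .. ?x i + h}) \<subseteq> coord_proj (dom \<kappa>) K"
    using shattered_imp_cube[OF K \<kappa>(1) fin] by (simp cong: PiE_cong)
  then have "dom \<kappa> \<in> cube_index_sets n K h"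
    using \<kappa>(2) False by (intro cube_index_setsI[of _ _ ?x]) simp_all
  then show ?thesis by (rule card_le_VC)
qed simp

lemma entropy_le_VC:
  assumes n: "n \<ge> 1" and K: "coord_convex K" and A: "finite A" "A \<subseteq> K"
    and t: "0 < t" "t \<le> 1"
    and bounded: "\<forall>x\<in>K. \<forall>i<n. \<bar>x i\<bar> \<le> 1"
    and sep: "\<forall>x\<in>A. \<forall>y\<in>A. x \<noteq> y \<longrightarrow> t\<^sup>2 * real n \<le> (\<Sum>i<n. (x i - y i)\<^sup>2)"
  shows "ln (card A) \<le> 52 * real (VC n K (t / 20)) * ln (2 / t)"
proof (rule card_separated_le[OF n A(1) t _ sep])
  show "\<forall>x\<in>A. \<forall>i<n. \<bar>x i\<bar> \<le> 1" using A bounded by blast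
qed (rule card_dom_shattered_le_VC[OF K A(2)])

text \<open>
  The entropy bound limits the cardinality of separated subsets, so there is a largest one, and
  its maximality makes it a net.
\<close>
lemma ex_finite_net:
  assumes n: "n \<ge> 1" and K: "coord_convex K" "K \<noteq> {}" and t: "0 < t" "t \<le> 1"
    and bounded: "\<forall>x\<in>K. \<forall>i<n. \<bar>x i\<bar> \<le> 1"
  shows "\<exists>A. finite A \<and> A \<noteq> {} \<and> A \<subseteq> K \<and> ln (card A) \<le> 52 * real (VC n K (t / 20)) * ln (2 / t) \<and>
    (\<forall>x\<in>K. \<exists>y\<in>A. (\<Sum>i<n. (x i - y i)\<^sup>2) \<le> t\<^sup>2 * real n)"
proof -
  define sepd where "sepd A \<longleftrightarrow> finite A \<and> A \<subseteq> K \<and>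
    (\<forall>x\<in>A. \<forall>y\<in>A. x \<noteq> y \<longrightarrow> t\<^sup>2 * real n \<le> (\<Sum>i<n. (x i - y i)\<^sup>2))" for A
  define L where "L = 52 * real (VC n K (t / 20)) * ln (2 / t)"
  have L: "ln (card A) \<le> L" if "sepd A" for A
    unfolding L_def using that by (intro entropy_le_VC[OF n K(1) _ _ t bounded]) (simp_all add: sepd_def)
  have bd: "card A < nat \<lceil>exp L\<rceil> + 1" if "sepd A" for A
  proof (cases "card A = 0")
    case False
    then have "real (card A) = exp (ln (card A))" by simp
    also have "\<dots> \<le> exp L" using L[OF that] by simp
    finally show ?thesis by linarith
  qed simp
  obtain x0 where "x0 \<in> K" using K by blast
  then have "sepd {x0}" by (simp add: sepd_def)
  then obtain A where A: "sepd A" "\<And>B. sepd B \<Longrightarrow> card B \<le> card A"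
    using ex_has_greatest_nat[of sepd "{x0}" card "nat \<lceil>exp L\<rceil> + 1"] bd by blast
  have fin: "finite A" using A by (simp add: sepd_def)
  have "card A \<ge> 1" using A(2)[OF \<open>sepd {x0}\<close>] by simp
  then have ne: "A \<noteq> {}" by auto
  have "\<exists>y\<in>A. (\<Sum>i<n. (x i - y i)\<^sup>2) \<le> t\<^sup>2 * real n" if x: "x \<in> K" for x
  proof (rule ccontr)
    assume "\<not> ?thesis"
    then have far: "\<And>y. y \<in> A \<Longrightarrow> t\<^sup>2 * real n < (\<Sum>i<n. (x i - y i)\<^sup>2)" by (meson not_le)
    have "x \<notin> A" using far[of x] t by (auto simp: mult_less_0_iff)
    have "sepd (insert x A)"
      using A(1) x far unfolding sepd_def by (auto simp: power2_commute less_imp_le)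
    then have "card (insert x A) \<le> card A" by (rule A(2))
    then show False using \<open>x \<notin> A\<close> fin by simp
  qed
  moreover have "A \<subseteq> K" using A(1) by (simp add: sepd_def)
  ultimately show ?thesis using L[OF A(1)] fin ne unfolding L_def by blast
qed


section \<open>Gaussian integrals\<close>
definition std_normal :: "real measure" where
  "std_normal = density lborel std_normal_density"

lemma prob_space_std_normal: "prob_space std_normal"
  unfolding std_normal_def by (rule prob_space_normal_density) simp

lemma has_integral_std_normal:
  assumes "has_bochner_integral lborel (\<lambda>x. std_normal_density x * f x) c" "f \<in> borel_measurable borel"
  shows "integrable std_normal f" "integral\<^sup>L std_normal f = c"
  using assms unfolding std_normal_def
  by (auto simp: integrable_density integral_density has_bochner_integral_iff)

lemma std_normal_exp:
  shows "integrable std_normal (\<lambda>x. exp (a * x))" "(\<integral>x. exp (a * x) \<partial>std_normal) = exp (a\<^sup>2 / 2)"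
proof -
  have "std_normal_density x * exp (a * x) = exp (a\<^sup>2 / 2) * normal_density a 1 x" for x
    by (simp add: normal_density_def exp_add[symmetric] power2_eq_square field_simps)
  then have "has_bochner_integral lborel (\<lambda>x. std_normal_density x * exp (a * x)) (exp (a\<^sup>2 / 2))"
    by (simp add: has_bochner_integral_iff)
  then show "integrable std_normal (\<lambda>x. exp (a * x))" "(\<integral>x. exp (a * x) \<partial>std_normal) = exp (a\<^sup>2 / 2)"
    by (rule has_integral_std_normal; simp)+
qed

lemma gaussian_product_eq: "gaussian_product n = (\<Pi>\<^sub>M i\<in>{..<n}. std_normal)"
  unfolding gaussian_product_def std_normal_def ..

lemma product_sigma_finite_std_normal: "product_sigma_finite (\<lambda>_. std_normal)"
  unfolding product_sigma_finite_def
  using prob_space_std_normal prob_space_imp_sigma_finite by blast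

lemma prob_space_gaussian_product: "prob_space (gaussian_product n)"
  unfolding gaussian_product_eq by (intro prob_space_PiM prob_space_std_normal)

text \<open>
  A function of one coordinate is a product over all coordinates whose other factors are \<open>1\<close>.
\<close>
lemma gaussian_coordinate:
  fixes f :: "real \<Rightarrow> real"
  assumes f: "integrable std_normal f" and i: "i < n"
  shows "integrable (gaussian_product n) (\<lambda>g. f (g i))"
    and "(\<integral>g. f (g i) \<partial>gaussian_product n) = integral\<^sup>L std_normal f"
proof -
  interpret product_sigma_finite "\<lambda>_. std_normal" by (rule product_sigma_finite_std_normal)
  interpret prob_space std_normal by (rule prob_space_std_normal)
  define h where "h j = (if j = i then f else (\<lambda>_. 1))" for j
  have eq: "(\<Prod>j<n. h j (g j)) = f (g i)" for g
    using i by (simp add: h_def if_distrib[of "\<lambda>f. f _"] cong: if_cong)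
  have h: "integrable std_normal (h j)" for j using f by (auto simp: h_def)
  show "integrable (gaussian_product n) (\<lambda>g. f (g i))"
    using product_integrable_prod[of "{..<n}" h] h by (simp add: eq gaussian_product_eq)
  have "(\<integral>g. (\<Prod>j<n. h j (g j)) \<partial>gaussian_product n) = (\<Prod>j<n. integral\<^sup>L std_normal (h j))"
    unfolding gaussian_product_eq using h by (intro product_integral_prod) auto
  also have "\<dots> = (\<Prod>j<n. if j = i then integral\<^sup>L std_normal f else 1)"
    by (intro prod.cong) (auto simp: h_def prob_space)
  finally show "(\<integral>g. f (g i) \<partial>gaussian_product n) = integral\<^sup>L std_normal f"
    using i by (simp add: eq)
qed

lemma gaussian_linear:
  shows "integrable (gaussian_product n) (\<lambda>g. \<Sum>i<n. v i * g i)"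
    and "(\<integral>g. (\<Sum>i<n. v i * g i) \<partial>gaussian_product n) = 0"
proof -
  have "integrable std_normal (\<lambda>x. x)" "(\<integral>x. x \<partial>std_normal) = 0"
    using std_normal_moment_odd[of 0] by (auto intro: has_integral_std_normal)
  note * = gaussian_coordinate[OF this(1), of _ n] this(2)
  show "integrable (gaussian_product n) (\<lambda>g. \<Sum>i<n. v i * g i)"
    using * by (intro Bochner_Integration.integrable_sum integrable_mult_right) auto
  show "(\<integral>g. (\<Sum>i<n. v i * g i) \<partial>gaussian_product n) = 0"
    using * by (subst Bochner_Integration.integral_sum) auto
qed

lemma gaussian_norm_square:
  shows "integrable (gaussian_product n) (\<lambda>g. \<Sum>i<n. (g i)\<^sup>2)"
    and "(\<integral>g. (\<Sum>i<n. (g i)\<^sup>2) \<partial>gaussian_product n) = n"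
proof -
  have "integrable std_normal (\<lambda>x. x\<^sup>2)" "(\<integral>x. x\<^sup>2 \<partial>std_normal) = 1"
    using std_normal_moment_even[of 1] by (auto intro!: has_integral_std_normal)
  note * = gaussian_coordinate[OF this(1), of _ n] this(2)
  show "integrable (gaussian_product n) (\<lambda>g. \<Sum>i<n. (g i)\<^sup>2)"
    using * by (intro Bochner_Integration.integrable_sum) auto
  show "(\<integral>g. (\<Sum>i<n. (g i)\<^sup>2) \<partial>gaussian_product n) = n"
    using * by (subst Bochner_Integration.integral_sum) auto
qed

lemma gaussian_exp:
  shows "integrable (gaussian_product n) (\<lambda>g. exp (\<Sum>i<n. v i * g i))"
    and "(\<integral>g. exp (\<Sum>i<n. v i * g i) \<partial>gaussian_product n) = exp ((\<Sum>i<n. (v i)\<^sup>2) / 2)"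
proof -
  interpret product_sigma_finite "\<lambda>_. std_normal" by (rule product_sigma_finite_std_normal)
  have eq: "exp (\<Sum>i<n. v i * g i) = (\<Prod>i<n. exp (v i * g i))" for g :: "nat \<Rightarrow> real"
    by (rule exp_sum) simp
  show "integrable (gaussian_product n) (\<lambda>g. exp (\<Sum>i<n. v i * g i))"
    unfolding eq gaussian_product_eq
    by (rule product_integrable_prod) (auto intro: std_normal_exp)
  have "(\<integral>g. exp (\<Sum>i<n. v i * g i) \<partial>gaussian_product n) = (\<Prod>i<n. exp ((v i)\<^sup>2 / 2))"
    unfolding eq gaussian_product_eq
    by (subst product_integral_prod) (auto intro: std_normal_exp simp: std_normal_exp(2))
  then show "(\<integral>g. exp (\<Sum>i<n. v i * g i) \<partial>gaussian_product n) = exp ((\<Sum>i<n. (v i)\<^sup>2) / 2)"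
    by (simp add: exp_sum[symmetric] sum_divide_distrib)
qed

text \<open>
  The usual bound for the expected maximum of finitely many Gaussian variables. It is stated
  through an integrable majorant \<open>F\<close> of the maximum, because majorants can be added along
  a chain. With \<open>Z\<close> the sum of the exponentials
  \<open>exp (l * _)\<close> and \<open>c\<close> a bound for its mean, \<open>F\<close> is the tangent of the concave function \<open>ln z / l\<close> at \<open>c\<close>, taken
  at \<open>Z\<close>; its integral is at most \<open>ln c / l\<close>, and \<open>l\<close> is the optimal parameter. For a single vector the
  bound is \<open>0\<close>, attained by the linear function itself; this case occurs when \<open>VC\<close> vanishes.
\<close>
lemma gaussian_finite_max:
  fixes V :: "(nat \<Rightarrow> real) set"
  assumes V: "finite V" "V \<noteq> {}" and R: "R > 0"
    and norm: "\<And>v. v \<in> V \<Longrightarrow> (\<Sum>i<n. (v i)\<^sup>2) \<le> R\<^sup>2"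
  obtains F where "integrable (gaussian_product n) F"
    and "\<And>g v. v \<in> V \<Longrightarrow> (\<Sum>i<n. v i * g i) \<le> F g"
    and "integral\<^sup>L (gaussian_product n) F \<le> R * sqrt (2 * ln (card V))"
proof (cases "card V = 1")
  case True
  then obtain v where v: "V = {v}" by (auto simp: card_1_singleton_iff)
  show ?thesis
    by (rule that[of "\<lambda>g. \<Sum>i<n. v i * g i"]) (simp_all add: v gaussian_linear)
next
  case False
  have "card V > 0" using V by (simp add: card_gt_0_iff)
  then have M: "card V \<ge> 2" using False by linarith
  interpret prob_space "gaussian_product n" by (rule prob_space_gaussian_product)
  define s where "s = sqrt (2 * ln (card V))"
  have s: "s > 0" "s\<^sup>2 = 2 * ln (card V)" using M by (auto simp: s_def)
  define l where "l = s / R"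
  have l: "l > 0" using s R by (simp add: l_def)
  define c where "c = real (card V) * exp (s\<^sup>2 / 2)"
  have c: "c > 0" using M by (simp add: c_def)
  have lnc: "ln c = s\<^sup>2" using M s(2) by (simp add: c_def ln_mult)
  define Z where "Z g = (\<Sum>v\<in>V. exp (\<Sum>i<n. (l * v i) * g i))" for g
  define F where "F g = (ln c - 1 + Z g / c) / l" for g
  have intZ: "integrable (gaussian_product n) Z"
    unfolding Z_def by (intro Bochner_Integration.integrable_sum gaussian_exp)
  have "integral\<^sup>L (gaussian_product n) Z = (\<Sum>v\<in>V. exp ((\<Sum>i<n. (l * v i)\<^sup>2) / 2))"
    unfolding Z_def by (simp add: Bochner_Integration.integral_sum gaussian_exp)
  also have "\<dots> \<le> (\<Sum>v\<in>V. exp (s\<^sup>2 / 2))"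
  proof (intro sum_mono)
    fix v assume "v \<in> V"
    have "(\<Sum>i<n. (l * v i)\<^sup>2) = l\<^sup>2 * (\<Sum>i<n. (v i)\<^sup>2)"
      by (simp add: power_mult_distrib sum_distrib_left)
    also have "\<dots> \<le> l\<^sup>2 * R\<^sup>2" using norm[OF \<open>v \<in> V\<close>] by (intro mult_left_mono) auto
    also have "\<dots> = s\<^sup>2" using R by (simp add: l_def power_divide)
    finally show "exp ((\<Sum>i<n. (l * v i)\<^sup>2) / 2) \<le> exp (s\<^sup>2 / 2)" by simp
  qed
  finally have Zc: "integral\<^sup>L (gaussian_product n) Z \<le> c" by (simp add: c_def)
  show ?thesis
  proof (rule that[of F])
    show "integrable (gaussian_product n) F" unfolding F_def using intZ by simp
    have "integral\<^sup>L (gaussian_product n) F = (ln c - 1 + integral\<^sup>L (gaussian_product n) Z / c) / l"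
      unfolding F_def using intZ by (simp add: prob_space)
    also have "\<dots> \<le> (ln c - 1 + 1) / l"
      using Zc c l by (intro divide_right_mono add_left_mono) (auto simp: divide_le_eq)
    also have "\<dots> = R * s" using s(1) R by (simp add: lnc l_def power2_eq_square)
    finally show "integral\<^sup>L (gaussian_product n) F \<le> R * sqrt (2 * ln (card V))" by (simp add: s_def)
  next
    fix g :: "nat \<Rightarrow> real" and v assume v: "v \<in> V"
    have le: "exp (\<Sum>i<n. (l * v i) * g i) \<le> Z g"
      unfolding Z_def using v V(1)
      by (intro member_le_sum[of v V "\<lambda>v. exp (\<Sum>i<n. (l * v i) * g i)"]) auto
    then have pos: "Z g > 0" using exp_gt_zero less_le_trans by blast
    have "l * (\<Sum>i<n. v i * g i) = ln (exp (\<Sum>i<n. (l * v i) * g i))"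
      by (simp add: sum_distrib_left mult_ac)
    also have "\<dots> \<le> ln (Z g)" using le by (intro ln_mono) auto
    also have "\<dots> = ln c + ln (Z g / c)" using c pos by (simp add: ln_div)
    also have "\<dots> \<le> ln c - 1 + Z g / c" using ln_le_minus_one[of "Z g / c"] c pos by simp
    finally show "(\<Sum>i<n. v i * g i) \<le> F g"
      using l by (simp add: F_def le_divide_eq mult.commute)
  qed
qed

section \<open>Chaining\<close>

text \<open>
  Let \<open>A j\<close> be the net at scale \<open>(1/2) ^ j\<close>. A point of \<open>A (Suc J)\<close> is a point of \<open>A J\<close> plus an increment of
  norm at most \<open>(1/2) ^ J * sqrt n\<close>, and there are at most \<open>card (A (Suc J))\<close> increments, since each
  point has only one predecessor. So a majorant for the coarser net and a majorant for the increments
  add up to one for the finer net.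
\<close>
lemma chaining:
  assumes n: "n \<ge> 1" and K: "coord_convex K" "K \<noteq> {}"
    and bounded: "\<forall>x\<in>K. \<forall>i<n. \<bar>x i\<bar> \<le> 1"
  shows "\<exists>A F. (\<forall>x\<in>K. \<exists>y\<in>A. (\<Sum>i<n. (x i - y i)\<^sup>2) \<le> ((1/2) ^ J)\<^sup>2 * real n) \<and>
    integrable (gaussian_product n) F \<and> (\<forall>g. \<forall>y\<in>A. (\<Sum>i<n. y i * g i) \<le> F g) \<and>
    integral\<^sup>L (gaussian_product n) F \<le> (\<Sum>j\<le>J. 2 * (1/2) ^ j * sqrt n *
       sqrt (2 * (52 * real (VC n K ((1/2) ^ j / 20)) * ln (2 / (1/2) ^ j))))"
proof -
  define L where "L j = 52 * real (VC n K ((1/2) ^ j / 20)) * ln (2 / (1/2) ^ j)" for j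
  define net where "net j A \<longleftrightarrow> finite A \<and> A \<noteq> {} \<and> A \<subseteq> K \<and> ln (card A) \<le> L j \<and>
     (\<forall>x\<in>K. \<exists>y\<in>A. (\<Sum>i<n. (x i - y i)\<^sup>2) \<le> ((1/2) ^ j)\<^sup>2 * real n)" for j A
  have "\<exists>A. net j A" for j
  proof -
    have "0 < (1/2 :: real) ^ j" "(1/2 :: real) ^ j \<le> 1" by (auto simp: power_le_one)
    from ex_finite_net[OF n K this bounded] show ?thesis unfolding L_def net_def .
  qed
  then obtain A where net: "\<And>j. net j (A j)" by metis
  then have A: "finite (A j)" "A j \<noteq> {}" "A j \<subseteq> K" "ln (card (A j)) \<le> L j"
     "\<forall>x\<in>K. \<exists>y\<in>A j. (\<Sum>i<n. (x i - y i)\<^sup>2) \<le> ((1/2) ^ j)\<^sup>2 * real n" for j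
    unfolding net_def by auto
  \<comment> \<open>Increments from \<open>A j\<close> to a predecessor map \<open>p\<close>. The radius is twice the scale because
      the predecessor belongs to the next coarser net.\<close>
  have step: "\<exists>F. integrable (gaussian_product n) F \<and> (\<forall>g. \<forall>y\<in>A j. (\<Sum>i<n. (y i - p y i) * g i) \<le> F g) \<and>
     integral\<^sup>L (gaussian_product n) F \<le> 2 * (1/2) ^ j * sqrt n * sqrt (2 * L j)"
    if p: "\<And>y. y \<in> A j \<Longrightarrow> (\<Sum>i<n. (y i - p y i)\<^sup>2) \<le> (2 * (1/2) ^ j * sqrt n)\<^sup>2" for j p
  proof -
    define V where "V = (\<lambda>y i. y i - p y i) ` A j"
    have V: "finite V" "V \<noteq> {}" using A by (auto simp: V_def)
    have "card V \<le> card (A j)" unfolding V_def using A by (intro card_image_le) auto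
    moreover have "card V > 0" using V by (simp add: card_gt_0_iff)
    ultimately have "ln (card V) \<le> ln (card (A j))" by (intro ln_mono) auto
    also have "\<dots> \<le> L j" by (rule A)
    finally have lnV: "ln (card V) \<le> L j" .
    have R: "0 < 2 * (1/2) ^ j * sqrt n" using n by simp
    obtain F where F: "integrable (gaussian_product n) F"
      "\<And>g v. v \<in> V \<Longrightarrow> (\<Sum>i<n. v i * g i) \<le> F g"
      "integral\<^sup>L (gaussian_product n) F \<le> 2 * (1/2) ^ j * sqrt n * sqrt (2 * ln (card V))"
      using gaussian_finite_max[OF V R, of n] p by (auto simp: V_def)
    have "2 * (1/2) ^ j * sqrt n * sqrt (2 * ln (card V)) \<le> 2 * (1/2) ^ j * sqrt n * sqrt (2 * L j)"
      using lnV by (intro mult_left_mono) auto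
    with F(3) have "integral\<^sup>L (gaussian_product n) F \<le> 2 * (1/2) ^ j * sqrt n * sqrt (2 * L j)" by linarith
    moreover have "\<forall>g. \<forall>y\<in>A j. (\<Sum>i<n. (y i - p y i) * g i) \<le> F g"
    proof (intro allI ballI)
      fix g y assume "y \<in> A j"
      then have "(\<lambda>i. y i - p y i) \<in> V" by (auto simp: V_def)
      from F(2)[OF this] show "(\<Sum>i<n. (y i - p y i) * g i) \<le> F g" .
    qed
    ultimately show ?thesis using F(1) by blast
  qed
  have "\<exists>F. integrable (gaussian_product n) F \<and> (\<forall>g. \<forall>y\<in>A J. (\<Sum>i<n. y i * g i) \<le> F g) \<and>
     integral\<^sup>L (gaussian_product n) F \<le> (\<Sum>j\<le>J. 2 * (1/2) ^ j * sqrt n * sqrt (2 * L j))"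
  proof (induction J)
    case 0
    \<comment> \<open>The chains start at the origin, which need not belong to \<open>K\<close>.\<close>
    have "\<exists>F. integrable (gaussian_product n) F \<and> (\<forall>g. \<forall>y\<in>A 0. (\<Sum>i<n. (y i - (\<lambda>_. 0) i) * g i) \<le> F g) \<and>
     integral\<^sup>L (gaussian_product n) F \<le> 2 * (1/2) ^ 0 * sqrt n * sqrt (2 * L 0)"
    proof (rule step)
      fix y assume "y \<in> A 0"
      then have "y \<in> K" using A by blast
      then have "(y i)\<^sup>2 \<le> 1" if "i < n" for i
        using bounded that by (simp add: abs_square_le_1)
      then have "(\<Sum>i<n. (y i)\<^sup>2) \<le> (\<Sum>i<n. 1)" by (intro sum_mono) auto
      then show "(\<Sum>i<n. (y i - 0)\<^sup>2) \<le> (2 * (1/2) ^ 0 * sqrt n)\<^sup>2"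
        by (simp add: power_mult_distrib)
    qed
    then show ?case by simp
  next
    case (Suc J)
    then obtain F where F: "integrable (gaussian_product n) F" "\<And>g y. y \<in> A J \<Longrightarrow> (\<Sum>i<n. y i * g i) \<le> F g"
      "integral\<^sup>L (gaussian_product n) F \<le> (\<Sum>j\<le>J. 2 * (1/2) ^ j * sqrt n * sqrt (2 * L j))"
      by blast
    obtain p where p: "\<And>x. x \<in> K \<Longrightarrow> p x \<in> A J"
      "\<And>x. x \<in> K \<Longrightarrow> (\<Sum>i<n. (x i - p x i)\<^sup>2) \<le> ((1/2) ^ J)\<^sup>2 * real n"
      using A(5)[of J] by metis
    have sub: "A (Suc J) \<subseteq> K" by (rule A)
    have "(\<Sum>i<n. (y i - p y i)\<^sup>2) \<le> (2 * (1/2) ^ Suc J * sqrt n)\<^sup>2" if "y \<in> A (Suc J)" for y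
      using p(2)[of y] sub that by (auto simp: power_mult_distrib)
    from step[OF this] obtain G where G: "integrable (gaussian_product n) G"
      "\<And>g y. y \<in> A (Suc J) \<Longrightarrow> (\<Sum>i<n. (y i - p y i) * g i) \<le> G g"
      "integral\<^sup>L (gaussian_product n) G \<le> 2 * (1/2) ^ Suc J * sqrt n * sqrt (2 * L (Suc J))"
      by blast
    have "(\<Sum>i<n. y i * g i) \<le> F g + G g" if "y \<in> A (Suc J)" for g y
    proof -
      have "(\<Sum>i<n. y i * g i) = (\<Sum>i<n. p y i * g i) + (\<Sum>i<n. (y i - p y i) * g i)"
        by (simp add: sum.distrib[symmetric] algebra_simps)
      also have "\<dots> \<le> F g + G g"
        using that sub by (intro add_mono F(2) G(2) p(1)) auto
      finally show ?thesis .
    qed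
    then show ?case using F G by (intro exI[of _ "\<lambda>g. F g + G g"]) auto
  qed
  with A(5)[of J] show ?thesis unfolding L_def by blast
qed


section \<open>From the sum over scales to the integral\<close>

text \<open>
  On the dyadic interval to the left of \<open>(1/2) ^ j\<close> the decreasing function is at least its value at
  \<open>(1/2) ^ j\<close>, and the length of that interval is half of \<open>(1/2) ^ j\<close>.
\<close>
lemma dyadic_sum_le_integral:
  fixes \<phi> :: "real \<Rightarrow> real"
  assumes nonneg: "\<And>t. 0 < t \<Longrightarrow> t \<le> 1 \<Longrightarrow> 0 \<le> \<phi> t"
    and antimono: "\<And>s t. 0 < s \<Longrightarrow> s \<le> t \<Longrightarrow> t \<le> 1 \<Longrightarrow> \<phi> t \<le> \<phi> s"
    and a: "0 < a" "a \<le> (1/2) ^ Suc J"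
    and int: "set_integrable lborel {a<..<1} \<phi>"
  shows "(\<Sum>j\<le>J. (1/2) ^ j * \<phi> ((1/2) ^ j)) \<le> 2 * (LBINT t:{a<..<1}. \<phi> t)"
proof -
  define b where "b j = (1/2 :: real) ^ j" for j
  have b: "0 < b j" "b j \<le> 1" "b (Suc j) = b j / 2" for j by (auto simp: b_def power_le_one)
  define \<psi> where "\<psi> J x = (\<Sum>j\<le>J. \<phi> (b j) * indicator {b (Suc j)<..<b j} x)" for J x
  have \<psi>: "\<psi> J x \<le> indicator {b (Suc J)<..<1} x * \<phi> x" for J x
  proof (induction J)
    case 0
    show ?case using antimono[of x 1] b(1)[of "Suc 0"] by (auto simp: \<psi>_def indicator_def b_def)
  next
    case (Suc J)
    have pos: "0 \<le> indicator {b (Suc (Suc J))<..<1} x * \<phi> x"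
      using nonneg[of x] b(1)[of "Suc (Suc J)"] by (auto simp: indicator_def)
    show ?case
    proof (cases "x \<in> {b (Suc (Suc J))<..<b (Suc J)}")
      case True
      then have "\<phi> (b (Suc J)) \<le> \<phi> x" using b[of "Suc J"] b(1)[of "Suc (Suc J)"] by (intro antimono) auto
      moreover have "x < 1" using True b(2)[of "Suc J"] by auto
      ultimately show ?thesis using Suc True by (simp add: \<psi>_def)
    next
      case False
      then have "\<psi> (Suc J) x \<le> indicator {b (Suc J)<..<1} x * \<phi> x" using Suc by (simp add: \<psi>_def)
      also have "\<dots> \<le> indicator {b (Suc (Suc J))<..<1} x * \<phi> x"
        using pos b(1,3)[of "Suc J"] by (auto simp: indicator_def)
      finally show ?thesis .
    qed
  qed
  have int\<psi>: "integrable lborel (\<lambda>x. \<phi> (b j) * indicator {b (Suc j)<..<b j} x)" for j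
    using b[of j] by (intro integrable_mult_right integrable_real_indicator) auto
  have "(\<Sum>j\<le>J. b j * \<phi> (b j)) = 2 * (\<Sum>j\<le>J. \<phi> (b j) * (b j - b (Suc j)))"
    unfolding sum_distrib_left by (intro sum.cong) (auto simp: b(3))
  also have "(\<Sum>j\<le>J. \<phi> (b j) * (b j - b (Suc j))) = integral\<^sup>L lborel (\<psi> J)"
  proof -
    have "measure lborel {b (Suc j)<..<b j} = b j - b (Suc j)" for j
      using b[of j] by (intro measure_lborel_Ioo) simp
    then show ?thesis unfolding \<psi>_def using int\<psi> by (subst Bochner_Integration.integral_sum) simp_all
  qed
  also have "\<dots> \<le> (LBINT t:{a<..<1}. \<phi> t)"
    unfolding set_lebesgue_integral_def
  proof (rule integral_mono)
    show "integrable lborel (\<psi> J)"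
      unfolding \<psi>_def using int\<psi> by (intro Bochner_Integration.integrable_sum) auto
    show "integrable lborel (\<lambda>x. indicator {a<..<1} x *\<^sub>R \<phi> x)"
      using int by (simp add: set_integrable_def)
    fix x
    have "\<psi> J x \<le> indicator {b (Suc J)<..<1} x * \<phi> x" by (rule \<psi>)
    also have "\<dots> \<le> indicator {a<..<1} x *\<^sub>R \<phi> x"
      using a nonneg[of x] by (auto simp: indicator_def b_def)
    finally show "\<psi> J x \<le> indicator {a<..<1} x *\<^sub>R \<phi> x" .
  qed
  finally show ?thesis by (simp add: b_def)
qed

text \<open>
  Without integrability the integral would be \<open>0\<close> by convention and give no upper bound.
\<close>
lemma entropy_integrand_integrable:
  assumes c: "c > 0" and a: "a > 0"
  shows "set_integrable lborel {a<..<1} (\<lambda>t. sqrt (VC n K (c * t)) * ln (2 / t))"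
proof -
  have "mono (\<lambda>t. - sqrt (VC n K (c * t)))"
    using c by (intro monoI) (simp add: VC_antimono)
  then have "(\<lambda>t. - sqrt (VC n K (c * t))) \<in> borel_measurable borel" by (rule borel_measurable_mono)
  then have "(\<lambda>t. - (- sqrt (VC n K (c * t)))) \<in> borel_measurable borel"
    by (rule borel_measurable_uminus)
  then have meas: "(\<lambda>t. sqrt (VC n K (c * t))) \<in> borel_measurable borel" by simp
  have "emeasure lborel {a<..<1} < \<infinity>" by (rule emeasure_bounded_finite[OF bounded_Ioo])
  then have "integrable lborel (\<lambda>t. (sqrt n * ln (2 / a)) * indicator {a<..<1} t)"
    by (intro integrable_mult_right integrable_real_indicator) simp_all
  then show ?thesis
    unfolding set_integrable_def
  proof (rule Bochner_Integration.integrable_bound)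
    show "(\<lambda>t. indicator {a<..<1} t *\<^sub>R (sqrt (VC n K (c * t)) * ln (2 / t))) \<in> borel_measurable lborel"
      using meas by simp
    have "sqrt (VC n K (c * t)) * ln (2 / t) \<le> sqrt n * ln (2 / a)" if "a < t" "t < 1" for t
      using that a VC_le[of n K "c * t"] by (intro mult_mono ln_mono) (auto simp: frac_le)
    then show "AE t in lborel. norm (indicator {a<..<1} t *\<^sub>R (sqrt (VC n K (c * t)) * ln (2 / t)))
        \<le> norm ((sqrt n * ln (2 / a)) * indicator {a<..<1} t)"
      using a by (intro AE_I2) (auto simp: indicator_def abs_mult)
  qed
qed

section \<open>The expected polar norm\<close>
lemma canonical_expansion: "(\<Sum>i<n. x i * (\<Sum>k<n. g k * canonical_vec k i)) = (\<Sum>i<n. x i * g i)"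
proof (rule sum.cong)
  fix i assume "i \<in> {..<n}"
  then show "x i * (\<Sum>k<n. g k * canonical_vec k i) = x i * g i"
    by (simp add: canonical_vec_def if_distrib[of "\<lambda>z. _ * z"] cong: if_cong)
qed simp

lemma expected_polar_norm_eq:
  "expected_polar_norm n K = (\<integral>g. (SUP x\<in>K. \<Sum>i<n. x i * g i) \<partial>gaussian_product n)"
  unfolding expected_polar_norm_def polar_norm_def canonical_expansion ..

lemma product_le_squares: "x * y \<le> (x\<^sup>2 / t + t * y\<^sup>2) / 2" if "t > 0" for t x y :: real
proof -
  have "0 \<le> (x - t * y)\<^sup>2 / t" using that by simp
  also have "\<dots> = x\<^sup>2 / t + t * y\<^sup>2 - 2 * (x * y)"
    using that by (simp add: power2_eq_square field_simps)
  finally show ?thesis by simp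
qed

text \<open>
  For \<open>x\<close> of norm at most \<open>t * sqrt n\<close>. Using the arithmetic-geometric mean inequality in each
  coordinate instead of the Cauchy-Schwarz inequality, one gets a quadratic majorant in \<open>g\<close>, whose
  integral is \<open>t * n\<close>.
\<close>
lemma inner_le_squares:
  assumes "t > 0" "(\<Sum>i<n. (x i)\<^sup>2) \<le> t\<^sup>2 * real n"
  shows "(\<Sum>i<n. x i * g i) \<le> t * (real n + (\<Sum>i<n. (g i)\<^sup>2)) / 2"
proof -
  have "(\<Sum>i<n. x i * g i) \<le> (\<Sum>i<n. ((x i)\<^sup>2 / t + t * (g i)\<^sup>2) / 2)"
    using assms(1) by (intro sum_mono product_le_squares)
  also have "\<dots> = ((\<Sum>i<n. (x i)\<^sup>2) / t + t * (\<Sum>i<n. (g i)\<^sup>2)) / 2"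
    by (simp add: sum.distrib sum_divide_distrib[symmetric] sum_distrib_left)
  also have "\<dots> \<le> (t * real n + t * (\<Sum>i<n. (g i)\<^sup>2)) / 2"
    using assms by (intro divide_right_mono add_right_mono) (auto simp: divide_le_eq power2_eq_square mult_ac)
  finally show ?thesis by (simp add: algebra_simps)
qed

lemma inner_le_of_unit_bounded:
  assumes "\<forall>i<n. \<bar>x i\<bar> \<le> 1"
  shows "(\<Sum>i<n. x i * g i) \<le> 1 * (real n + (\<Sum>i<n. (g i)\<^sup>2)) / 2"
proof (rule inner_le_squares)
  have "(\<Sum>i<n. (x i)\<^sup>2) \<le> (\<Sum>i<n. 1)" using assms by (intro sum_mono) (auto simp: abs_square_le_1)
  then show "(\<Sum>i<n. (x i)\<^sup>2) \<le> 1\<^sup>2 * real n" by simp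
qed simp

lemma expected_polar_norm_le:
  assumes K: "K \<noteq> {}" and int: "integrable (gaussian_product n) (\<lambda>g. SUP x\<in>K. \<Sum>i<n. x i * g i)"
    and F: "integrable (gaussian_product n) F"
    and le: "\<And>x g. x \<in> K \<Longrightarrow> (\<Sum>i<n. x i * g i) \<le> F g + t * (real n + (\<Sum>i<n. (g i)\<^sup>2)) / 2"
  shows "expected_polar_norm n K \<le> integral\<^sup>L (gaussian_product n) F + t * real n"
proof -
  interpret prob_space "gaussian_product n" by (rule prob_space_gaussian_product)
  note sq = gaussian_norm_square[of n]
  have int2: "integrable (gaussian_product n) (\<lambda>g. t * (real n + (\<Sum>i<n. (g i)\<^sup>2)) / 2)"
    using sq by (intro integrable_divide integrable_mult_right Bochner_Integration.integrable_add) auto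
  have "(\<integral>g. real n + (\<Sum>i<n. (g i)\<^sup>2) \<partial>gaussian_product n) = real n + real n"
    using sq by (subst Bochner_Integration.integral_add) (auto simp: prob_space)
  then have "(\<integral>g. t * (real n + (\<Sum>i<n. (g i)\<^sup>2)) / 2 \<partial>gaussian_product n) = t * real n"
    by simp
  moreover have "expected_polar_norm n K \<le> (\<integral>g. F g + t * (real n + (\<Sum>i<n. (g i)\<^sup>2)) / 2 \<partial>gaussian_product n)"
    unfolding expected_polar_norm_eq
    using int F int2 by (intro integral_mono Bochner_Integration.integrable_add cSUP_least K le)
  ultimately show ?thesis using Bochner_Integration.integral_add[OF F int2] by linarith
qed

text \<open>
  The supremum dominates a single linear functional, which has mean \<open>0\<close>. If the supremum were not
  integrable, its integral would be \<open>0\<close> by convention.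
\<close>
lemma expected_polar_norm_nonneg:
  assumes "K \<noteq> {}" "\<forall>x\<in>K. \<forall>i<n. \<bar>x i\<bar> \<le> 1"
  shows "0 \<le> expected_polar_norm n K"
proof (cases "integrable (gaussian_product n) (\<lambda>g. SUP x\<in>K. \<Sum>i<n. x i * g i)")
  case True
  obtain x where x: "x \<in> K" using assms by blast
  have "(\<integral>g. (\<Sum>i<n. x i * g i) \<partial>gaussian_product n) \<le> expected_polar_norm n K"
    unfolding expected_polar_norm_eq
  proof (intro integral_mono gaussian_linear True cSUP_upper x)
    fix g :: "nat \<Rightarrow> real"
    show "bdd_above ((\<lambda>x. \<Sum>i<n. x i * g i) ` K)"
      using inner_le_of_unit_bounded[of n _ g] assms(2) by (intro bdd_aboveI2) blast
  qed
  then show ?thesis by (simp add: gaussian_linear)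
qed (simp add: expected_polar_norm_eq not_integrable_integral_eq)

text \<open>
  Dudley's integral has \<open>sqrt l\<close> with \<open>l = ln (2 / s)\<close>. Here it is replaced by a multiple of \<open>l\<close>, which is
  possible as \<open>l\<close> is bounded below.
\<close>
lemma chaining_term_le:
  fixes V l s :: real and n :: nat
  assumes V: "0 \<le> V" and l: "ln 2 \<le> l" and s: "0 \<le> s"
  shows "2 * s * sqrt n * sqrt (2 * (52 * V * l)) \<le> 33 * sqrt n * (s * (sqrt V * l))"
proof -
  have l': "2 / 3 \<le> l" using l ln2_ge_two_thirds by linarith
  have "sqrt (2 * (52 * V * l)) \<le> 33 / 2 * (sqrt V * l)"
  proof (rule real_le_lsqrt)
    have "104 * (V * l) \<le> (33 / 2)\<^sup>2 * (V * (l * (2 / 3)))"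
      using V l' by (simp add: power2_eq_square)
    also have "\<dots> \<le> (33 / 2)\<^sup>2 * (V * (l * l))"
      using V l' by (intro mult_left_mono) auto
    also have "\<dots> = (33 / 2 * (sqrt V * l))\<^sup>2"
      using V by (simp add: power_mult_distrib power2_eq_square)
    finally show "2 * (52 * V * l) \<le> (33 / 2 * (sqrt V * l))\<^sup>2" by simp
  qed (use V l' in auto)
  then have "2 * s * sqrt n * sqrt (2 * (52 * V * l)) \<le> 2 * s * sqrt n * (33 / 2 * (sqrt V * l))"
    using s by (intro mult_left_mono) auto
  then show ?thesis by (simp add: mult_ac)
qed

text \<open>
  The number \<open>J\<close> of scales is the last one for which \<open>a\<close> lies below all the dyadic intervals that are used.
  Then \<open>(1/2) ^ J < 4 * a\<close>, so what happens below the scale \<open>(1/2) ^ J\<close> contributes at most \<open>E / 5\<close>. The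
  positivity of \<open>E\<close> also yields the integrability of the supremum, because the integral of a
  function that is not integrable is \<open>0\<close>.
\<close>
lemma entropy_integral_bound:
  assumes n: "n \<ge> 1" and K: "coord_convex K" "K \<noteq> {}"
    and bounded: "\<forall>x\<in>K. \<forall>i<n. \<bar>x i\<bar> \<le> 1"
    and E: "0 < expected_polar_norm n K"
    and a_def: "a = expected_polar_norm n K / (20 * real n)"
  shows "expected_polar_norm n K \<le> 83 * sqrt n * (LBINT t:{a<..<1}. sqrt (VC n K (1/20 * t)) * ln (2 / t))"
proof -
  define E where "E = expected_polar_norm n K"
  define \<phi> where "\<phi> t = sqrt (VC n K (1/20 * t)) * ln (2 / t)" for t
  have int: "integrable (gaussian_product n) (\<lambda>g. SUP x\<in>K. \<Sum>i<n. x i * g i)"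
  proof (rule ccontr)
    assume "\<not> ?thesis"
    then have "expected_polar_norm n K = 0"
      unfolding expected_polar_norm_eq by (rule not_integrable_integral_eq)
    then show False using E by simp
  qed
  have "E \<le> integral\<^sup>L (gaussian_product n) (\<lambda>_. 0) + 1 * real n"
    unfolding E_def
    using inner_le_of_unit_bounded bounded by (intro expected_polar_norm_le K int) auto
  then have "E \<le> real n" by simp
  then have a: "0 < a" "a \<le> 1 / 2" using E n by (auto simp: a_def E_def divide_le_eq)
  obtain m where "(1/2 :: real) ^ m < a" using a real_arch_pow_inv[of a "1/2"] by auto
  then have "(1/2 :: real) ^ (m + 2) < a"
    using power_decreasing[of m "m + 2" "1/2 :: real"] by linarith
  then have ex: "\<exists>J. (1/2 :: real) ^ (J + 2) < a" by blast
  define J where "J = (LEAST J. (1/2 :: real) ^ (J + 2) < a)"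
  have J1: "(1/2 :: real) ^ (J + 2) < a" unfolding J_def using ex by (rule LeastI_ex)
  have J2: "a \<le> (1/2) ^ Suc J"
  proof (cases J)
    case (Suc i)
    then have "\<not> (1/2 :: real) ^ (i + 2) < a" unfolding J_def by (metis lessI not_less_Least)
    then show ?thesis using Suc by simp
  qed (use a in simp)
  obtain A F where A: "\<forall>x\<in>K. \<exists>y\<in>A. (\<Sum>i<n. (x i - y i)\<^sup>2) \<le> ((1/2) ^ J)\<^sup>2 * real n"
    and F: "integrable (gaussian_product n) F" "\<forall>g. \<forall>y\<in>A. (\<Sum>i<n. y i * g i) \<le> F g"
      "integral\<^sup>L (gaussian_product n) F \<le> (\<Sum>j\<le>J. 2 * (1/2) ^ j * sqrt n *
         sqrt (2 * (52 * real (VC n K ((1/2) ^ j / 20)) * ln (2 / (1/2) ^ j))))"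
    using chaining[OF n K bounded, of J] by (elim exE conjE)
  have "E \<le> integral\<^sup>L (gaussian_product n) F + (1/2) ^ J * real n"
    unfolding E_def
  proof (rule expected_polar_norm_le[OF K(2) int F(1)])
    fix x and g :: "nat \<Rightarrow> real" assume "x \<in> K"
    then obtain y where y: "y \<in> A" "(\<Sum>i<n. (x i - y i)\<^sup>2) \<le> ((1/2) ^ J)\<^sup>2 * real n"
      using A by blast
    have "(\<Sum>i<n. x i * g i) = (\<Sum>i<n. y i * g i) + (\<Sum>i<n. (x i - y i) * g i)"
      by (simp add: sum.distrib[symmetric] algebra_simps)
    also have "\<dots> \<le> F g + (1/2) ^ J * (real n + (\<Sum>i<n. (g i)\<^sup>2)) / 2"
      by (intro add_mono F(2)[rule_format] y(1) inner_le_squares y(2)) simp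
    finally show "(\<Sum>i<n. x i * g i) \<le> F g + (1/2) ^ J * (real n + (\<Sum>i<n. (g i)\<^sup>2)) / 2" .
  qed
  moreover have "(1/2) ^ J * real n \<le> E / 5"
  proof -
    have "(1/2) ^ J * real n \<le> 4 * a * real n"
      using J1 by (intro mult_right_mono) auto
    also have "\<dots> = E / 5" using n by (simp add: a_def E_def)
    finally show ?thesis .
  qed
  moreover have "integral\<^sup>L (gaussian_product n) F \<le> 66 * (sqrt n * (LBINT t:{a<..<1}. \<phi> t))"
  proof -
    have "integral\<^sup>L (gaussian_product n) F \<le> (\<Sum>j\<le>J. 33 * sqrt n * ((1/2) ^ j * \<phi> ((1/2) ^ j)))"
    proof (rule order_trans[OF F(3)], rule sum_mono)
      fix j
      have "(1/2 :: real) ^ j \<le> 1" by (simp add: power_le_one)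
      then have "ln 2 \<le> ln (2 / (1/2 :: real) ^ j)" by (intro ln_mono) (auto simp: le_divide_eq)
      then show "2 * (1/2) ^ j * sqrt n * sqrt (2 * (52 * real (VC n K ((1/2) ^ j / 20)) * ln (2 / (1/2) ^ j)))
        \<le> 33 * sqrt n * ((1/2) ^ j * \<phi> ((1/2) ^ j))"
        using chaining_term_le[of "real (VC n K ((1/2) ^ j / 20))" "ln (2 / (1/2) ^ j)" "(1/2) ^ j" n]
        by (simp add: \<phi>_def)
    qed
    also have "\<dots> = 33 * sqrt n * (\<Sum>j\<le>J. (1/2) ^ j * \<phi> ((1/2) ^ j))"
      by (rule sum_distrib_left[symmetric])
    also have "\<dots> \<le> 33 * sqrt n * (2 * (LBINT t:{a<..<1}. \<phi> t))"
    proof (intro mult_left_mono dyadic_sum_le_integral a J2)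
      show "set_integrable lborel {a<..<1} \<phi>"
        unfolding \<phi>_def using a by (intro entropy_integrand_integrable) auto
      show "0 \<le> \<phi> t" if "0 < t" "t \<le> 1" for t using that by (simp add: \<phi>_def)
      show "\<phi> t \<le> \<phi> s" if "0 < s" "s \<le> t" "t \<le> 1" for s t
        unfolding \<phi>_def using that VC_antimono[of "1/20 * s" "1/20 * t" n K]
        by (intro mult_mono ln_mono) (auto simp: frac_le)
    qed auto
    finally show ?thesis by simp
  qed
  ultimately have "4 / 5 * E \<le> 66 * (sqrt n * (LBINT t:{a<..<1}. \<phi> t))" by linarith
  then have "E \<le> 83 * (sqrt n * (LBINT t:{a<..<1}. \<phi> t))"
    using E by (simp add: E_def)
  then show ?thesis by (simp add: E_def \<phi>_def)
qed

text \<open>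
  The constants are \<open>C = 83\<close> and \<open>c = 1/20\<close>. If \<open>E = 0\<close>, the integrand is nonnegative on \<open>(0, 1)\<close> and there is
  nothing to show. Otherwise \<open>entropy_integral_bound\<close> applies; it only remains to pass from the set integral to
  the interval integral, for which the lower limit has to be at most \<open>1\<close>.
\<close>
theorem theorem4p1:
  shows "\<exists>C>0. \<exists>c>0. \<forall>n::nat. \<forall>K. n \<ge> 1 \<longrightarrow> convex_body n K \<longrightarrow> K \<subseteq> sup_cube n \<longrightarrow>
    expected_polar_norm n K \<le>
      C * sqrt (real n) *
        (LBINT t = ereal (c * expected_polar_norm n K / real n)..ereal 1.
           sqrt (real (VC n K (c * t))) * ln (2 / t))"
proof (rule exI[of _ 83], rule conjI, simp, rule exI[of _ "1/20"], rule conjI, simp, intro allI impI)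
  fix n :: nat and K
  assume n: "n \<ge> 1" and body: "convex_body n K" and cube: "K \<subseteq> sup_cube n"
  have "coord_convex K"
    using body unfolding convex_body_def coord_convex_def by (elim conjE)
  moreover have "K \<noteq> {}"
    using body interior_of_subset[of "Euclidean_space n" K] by (auto simp: convex_body_def)
  ultimately have K: "coord_convex K" "K \<noteq> {}" .
  have bounded: "\<forall>x\<in>K. \<forall>i<n. \<bar>x i\<bar> \<le> 1"
    using cube by (auto simp: sup_cube_def abs_le_iff)
  define E where "E = expected_polar_norm n K"
  define a where "a = 1 / 20 * E / real n"
  define I where "I = (LBINT t:{a<..<1}. sqrt (VC n K (1/20 * t)) * ln (2 / t))"
  have "0 \<le> E" unfolding E_def using K(2) bounded by (rule expected_polar_norm_nonneg)
  then have a0: "0 \<le> a" by (simp add: a_def)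
  have "0 \<le> I"
    unfolding I_def set_lebesgue_integral_def using a0
    by (intro Bochner_Integration.integral_nonneg) (auto simp: indicator_def)
  have E_le: "E \<le> 83 * sqrt n * I"
  proof (cases "E = 0")
    case True
    then show ?thesis using \<open>0 \<le> I\<close> by simp
  next
    case False
    then show ?thesis
      using entropy_integral_bound[OF n K bounded, of a] \<open>0 \<le> E\<close> by (simp add: E_def I_def a_def)
  qed
  \<comment> \<open>For \<open>1 < a\<close> the set integral would be over the empty set, and the bound would give \<open>E = 0\<close>.\<close>
  have "a \<le> 1"
  proof (rule ccontr)
    assume "\<not> a \<le> 1"
    then have "I = 0" unfolding I_def by (simp add: set_lebesgue_integral_def)
    then have "E = 0" using E_le \<open>0 \<le> E\<close> by simp
    then show False using \<open>\<not> a \<le> 1\<close> by (simp add: a_def)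
  qed
  then have "(LBINT t=ereal a..ereal 1. sqrt (VC n K (1/20 * t)) * ln (2 / t)) = I"
    unfolding I_def by (simp add: interval_integral_Ioo)
  then show "expected_polar_norm n K \<le> 83 * sqrt (real n) *
      (LBINT t = ereal (1/20 * expected_polar_norm n K / real n)..ereal 1.
         sqrt (real (VC n K (1/20 * t))) * ln (2 / t))"
    using E_le unfolding E_def a_def by simp
qed

end
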